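(* Let $F$ be a singular fiber of Kodaira type $I_n^*$, $n\geq1$, of an elliptic fibration on a smooth $K3$ surface, written $$F=C_0'+C_0''+2C_0+2C_1+\cdots+2C_n+C_n'+C_n''.$$ Let $R$ be an ADER in $F$ with $C_0,C_n\subset\operatorname{Supp}(R)$. Then exactly one of the following two cases occurs. (1) The connected component $\Gamma_L$ of $R$ containing $C_0$ is different from the connected component $\Gamma_R$ of $R$ containing $C_n$. In this case let $c_L$ (resp. $c_R$) be the number of the components $C_0,\dots,C_n$ contained in $\Gamma_L$ (resp. $\Gamma_R$). Then $R=\Gamma_L+R_M+\Gamma_R$, where $R_M$ is supported on the chain $C_{c_L+1}-C_{c_L+2}-\cdots-C_{n-c_R-1}$, and $R_M$ is either zero or of type $A_{\lambda_1}\oplus\cdots\oplus A_{\lambda_r}$ for some $\lambda_1,\dots,\lambda_r\geq1$ satisfying $$\sum_{i=1}^r\lambda_i+r\leq n-c_L-c_R.$$ If $R_M=0$, then $c_L+c_R\leq n$. Moreover $\Gamma_L$ is one of the following: (a) $\Gamma_L=C_0+C_1+\cdots+C_{p_L-1}$ for some $1\leq p_L\leq n$, of type $A_{p_L}$; (b) $\Gamma_L=L+C_0+C_1+\cdots+C_{p_L-1}$ for some $L\in\{C_0',C_0''\}$ and $1\leq p_L\leq n$, of type $A_{p_L+1}$; (c) $\Gamma_L=C_0'+C_0+C_0''$, of type $A_3^{\mathrm{sp}}$; (d) $\Gamma_L=C_0'+C_0''+C_0+C_1+\cdots+C_{p_L-1}$ for some $2\leq p_L\leq n$, of type $D_{p_L+2}$.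 In cases (a), (b), (d) one has $c_L=p_L$, while in case (c) one has $c_L=1$. The component $\Gamma_R$ is described symmetrically at the right end, with $p_R$ defined in the same way; in particular $c_R=p_R$ in the three non-special cases, and $c_R=1$ in the special case $\Gamma_R=C_n'+C_n+C_n''$ (of type $A_3^{\mathrm{sp}}$). (2) A single connected component of $R$ contains both $C_0$ and $C_n$. Then $R$ is connected and one of the following occurs: (a) $R=C_0+C_1+\cdots+C_n$, of type $A_{n+1}$; (b) $R=L+C_0+C_1+\cdots+C_n$ for some $L\in\{C_0',C_0'',C_n',C_n''\}$, of type $A_{n+2}$; (c) $R=L_0+C_0+C_1+\cdots+C_n+L_n$ for some $L_0\in\{C_0',C_0''\}$ and $L_n\in\{C_n',C_n''\}$, of type $A_{n+3}$; (d) $R=C_0'+C_0''+C_0+C_1+\cdots+C_n$, or symmetrically $R=C_0+C_1+\cdots+C_n+C_n'+C_n''$, of type $D_{n+3}$; (e) $R=C_0'+C_0''+C_0+C_1+\cdots+C_n+L_n$ for some $L_n\in\{C_n',C_n''\}$, or symmetrically $R=L_0+C_0+C_1+\cdots+C_n+C_n'+C_n''$ for some $L_0\in\{C_0',C_0''\}$, of type $D_{n+4}$. Conversely, a reduced subdivisor $R$ of $F$ is an ADER if either $R=\Gamma_L+R_M+\Gamma_R$ with $\Gamma_L$ as in one of (1)(a)–(d), $\Gamma_R$ as in one of the mirror-image cases at the right end, $c_L+c_R\leq n$, and $R_M$ zero or a disjoint union of consecutive subchains (pairwise separated by at least one unused vertex) of $C_{c_L+1}-\cdots-C_{n-c_R-1}$,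 of type $A_{\lambda_1}\oplus\cdots\oplus A_{\lambda_r}$ with $\sum_{i=1}^r\lambda_i+r\leq n-c_L-c_R$ if nonzero; or $R$ is one of the divisors listed in (2)(a)–(e).
   Context: We work over an algebraically closed field of characteristic $0$. In a fiber of type $I_n^*$ ($n\ge1$) all components are smooth rational $(-2)$-curves, meeting transversely in at most one point, with dual graph $\widetilde D_{n+4}$: $C_0-C_1-\cdots-C_n$ is a chain, the leaves $C_0',C_0''$ are attached to $C_0$ and the leaves $C_n',C_n''$ to $C_n$. The chain $C_{c_L+1}-\cdots-C_{n-c_R-1}$ is empty if $c_L+c_R\geq n-1$. An ADE reduced divisor (ADER) in $F$ is a reduced subdivisor of $F$ (a sum of distinct components) whose dual graph is a disjoint union of Dynkin diagrams of type $A_k$, $D_l$ ($l\ge4$), $E_6,E_7,E_8$; its type is the type of this graph, with $\oplus$ denoting disjoint union. $A_3^{\mathrm{sp}}$ denotes the special configuration $C_0'+C_0+C_0''$ or $C_n'+C_n+C_n''$, of Dynkin type $A_3$. *)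

theory Defs
  imports Main "HOL-Library.Multiset"
begin

section \<open>Graphs and Dynkin diagrams\<close>

text \<open>A graph is a pair of a vertex set and a symmetric irreflexive edge relation on it.\<close>

type_synonym 'v graph = "'v set \<times> ('v \<times> 'v) set"

definition sym_closure :: "('v \<times> 'v) set \<Rightarrow> ('v \<times> 'v) set" where
  "sym_closure r = r \<union> r\<inverse>"

definition graph_iso :: "'v graph \<Rightarrow> 'w graph \<Rightarrow> bool" where
  "graph_iso G H \<longleftrightarrow> (\<exists>f. bij_betw f (fst G) (fst H) \<and>
     (\<forall>x\<in>fst G. \<forall>y\<in>fst G. (x, y) \<in> snd G \<longleftrightarrow> (f x, f y) \<in> snd H))"

datatype dynkin = DynA nat | DynD nat | DynE nat

fun dynkin_valid :: "dynkin \<Rightarrow> bool" where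
  "dynkin_valid (DynA k) \<longleftrightarrow> k \<ge> 1"
| "dynkin_valid (DynD l) \<longleftrightarrow> l \<ge> 4"
| "dynkin_valid (DynE m) \<longleftrightarrow> m \<in> {6, 7, 8}"

text \<open>The vertices are numbered from 1. In type D and E the last vertex is the one
  outside the long chain; it is attached to the vertex \<open>l - 2\<close>, respectively \<open>3\<close>.\<close>

fun dynkin_graph :: "dynkin \<Rightarrow> nat graph" where
  "dynkin_graph (DynA k) =
     ({1..k}, sym_closure {(i, i + 1) | i. 1 \<le> i \<and> i + 1 \<le> k})"
| "dynkin_graph (DynD l) =
     ({1..l}, sym_closure ({(i, i + 1) | i. 1 \<le> i \<and> i + 1 \<le> l - 1} \<union> {(l - 2, l)}))"
| "dynkin_graph (DynE m) =
     ({1..m}, sym_closure ({(i, i + 1) | i. 1 \<le> i \<and> i + 1 \<le> m - 1} \<union> {(3, m)}))"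

definition disjoint_union :: "'v graph list \<Rightarrow> (nat \<times> 'v) graph" where
  "disjoint_union Gs =
     ({(i, v). i < length Gs \<and> v \<in> fst (Gs ! i)},
      {((i, u), (i, v)) | i u v. i < length Gs \<and> (u, v) \<in> snd (Gs ! i)})"

text \<open>The multiset \<open>{#T\<^sub>1, \<dots>, T\<^sub>r#}\<close> stands for the type \<open>T\<^sub>1 \<oplus> \<dots> \<oplus> T\<^sub>r\<close>.\<close>

definition graph_has_type :: "'v graph \<Rightarrow> dynkin multiset \<Rightarrow> bool" where
  "graph_has_type G M \<longleftrightarrow> (\<forall>T\<in>#M. dynkin_valid T) \<and>
     (\<exists>Ts. mset Ts = M \<and> graph_iso G (disjoint_union (map dynkin_graph Ts)))"


section \<open>Effective divisors\<close>

text \<open>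
  An effective divisor is a finite multiset of irreducible curves (elements of a type
  \<open>'c\<close>), so \<open>+\<close> is the sum of divisors, \<open>{#}\<close> is the zero divisor and
  \<open>\<subseteq>#\<close> is the relation of being a subdivisor. The function \<open>isect\<close> gives
  the intersection numbers of the curves.
\<close>

definition reduced :: "'c multiset \<Rightarrow> bool" where
  "reduced R \<longleftrightarrow> (\<forall>X\<in>#R. count R X = 1)"

text \<open>No edge multiplicities are recorded: the curves considered below meet
  transversely in at most one point.\<close>

definition dual_graph :: "('c \<Rightarrow> 'c \<Rightarrow> int) \<Rightarrow> 'c multiset \<Rightarrow> 'c graph" where
  "dual_graph isect R =
     (set_mset R, {(X, Y). X \<in># R \<and> Y \<in># R \<and> X \<noteq> Y \<and> isect X Y > 0})"

definition has_type :: "('c \<Rightarrow> 'c \<Rightarrow> int) \<Rightarrow> 'c multiset \<Rightarrow> dynkin multiset \<Rightarrow> bool" where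
  "has_type isect R M \<longleftrightarrow> graph_has_type (dual_graph isect R) M"

definition component_of :: "('c \<Rightarrow> 'c \<Rightarrow> int) \<Rightarrow> 'c multiset \<Rightarrow> 'c \<Rightarrow> 'c multiset" where
  "component_of isect R X = filter_mset (\<lambda>Y. (X, Y) \<in> (snd (dual_graph isect R))\<^sup>*) R"

definition components :: "('c \<Rightarrow> 'c \<Rightarrow> int) \<Rightarrow> 'c multiset \<Rightarrow> 'c multiset set" where
  "components isect R = component_of isect R ` set_mset R"

definition connected_divisor :: "('c \<Rightarrow> 'c \<Rightarrow> int) \<Rightarrow> 'c multiset \<Rightarrow> bool" where
  "connected_divisor isect R \<longleftrightarrow> components isect R = {R}"

definition ADER :: "('c \<Rightarrow> 'c \<Rightarrow> int) \<Rightarrow> 'c multiset \<Rightarrow> 'c multiset \<Rightarrow> bool" where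
  "ADER isect F R \<longleftrightarrow> R \<subseteq># F \<and> reduced R \<and> (\<exists>M. has_type isect R M)"


section \<open>Fibers of type \<open>I\<^sub>n\<^sup>*\<close>\<close>

text \<open>
  The labelled components of a fiber \<open>F\<close> of type \<open>I\<^sub>n\<^sup>*\<close>, with their multiplicities and
  their intersection numbers. The surface itself is not modelled.
\<close>

locale In_star_fiber =
  fixes isect :: "'c \<Rightarrow> 'c \<Rightarrow> int"
    and n :: nat
    and F :: "'c multiset"
    and C0' C0'' :: 'c
    and C :: "nat \<Rightarrow> 'c"
    and Cn' Cn'' :: 'c
  assumes n_ge_1: "n \<ge> 1"
    and distinct_components: "distinct ([C0', C0'', Cn', Cn''] @ map C [0..<n + 1])"
    and fiber_eq: "F = {#C0', C0''#} + repeat_mset 2 (\<Sum>i\<le>n. {#C i#}) + {#Cn', Cn''#}"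
    and self_inter: "\<And>X. X \<in># F \<Longrightarrow> isect X X = - 2"
    and inter_eq: "\<And>X Y. X \<in># F \<Longrightarrow> Y \<in># F \<Longrightarrow> X \<noteq> Y \<Longrightarrow>
      isect X Y =
        (if (X, Y) \<in> sym_closure ({(C i, C (i + 1)) | i. i < n} \<union>
              {(C 0, C0'), (C 0, C0''), (C n, Cn'), (C n, Cn'')})
         then 1 else 0)"

text \<open>The special configuration \<open>A\<^sub>3\<^sup>s\<^sup>p\<close>: an end curve of the chain with its two leaves.\<close>

definition A3_sp :: "'c \<Rightarrow> 'c \<Rightarrow> 'c \<Rightarrow> 'c multiset" where
  "A3_sp L' K L'' = {#L'#} + {#K#} + {#L''#}"

text \<open>
  \<open>end_shape n L' L'' K \<Gamma> c T\<close> lists the possible components at the end \<open>K 0\<close> of the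
  chain \<open>K 0, \<dots>, K n\<close> with leaves \<open>L'\<close> and \<open>L''\<close> at \<open>K 0\<close>. Here \<open>c\<close> is the asserted number
  of chain curves in \<open>\<Gamma>\<close>, and \<open>T\<close> the asserted Dynkin type; that they are the actual
  number and type is not part of the definition. At the right end of a fiber
  one takes \<open>K i = C (n - i)\<close>.
\<close>

inductive end_shape ::
    "nat \<Rightarrow> 'c \<Rightarrow> 'c \<Rightarrow> (nat \<Rightarrow> 'c) \<Rightarrow> 'c multiset \<Rightarrow> nat \<Rightarrow> dynkin \<Rightarrow> bool"
  for n L' L'' K where
  end_a: "1 \<le> p \<Longrightarrow> p \<le> n \<Longrightarrow>
    end_shape n L' L'' K (\<Sum>i<p. {#K i#}) p (DynA p)"
| end_b: "L \<in> {L', L''} \<Longrightarrow> 1 \<le> p \<Longrightarrow> p \<le> n \<Longrightarrow>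
    end_shape n L' L'' K ({#L#} + (\<Sum>i<p. {#K i#})) p (DynA (p + 1))"
| end_c: "end_shape n L' L'' K (A3_sp L' (K 0) L'') 1 (DynA 3)"
| end_d: "2 \<le> p \<Longrightarrow> p \<le> n \<Longrightarrow>
    end_shape n L' L'' K ({#L', L''#} + (\<Sum>i<p. {#K i#})) p (DynD (p + 2))"

text \<open>Likewise for the divisors whose support contains the whole chain.\<close>

inductive full_shape ::
    "nat \<Rightarrow> 'c \<Rightarrow> 'c \<Rightarrow> (nat \<Rightarrow> 'c) \<Rightarrow> 'c \<Rightarrow> 'c \<Rightarrow> 'c multiset \<Rightarrow> dynkin \<Rightarrow> bool"
  for n C0' C0'' C Cn' Cn'' where
  full_a: "full_shape n C0' C0'' C Cn' Cn'' (\<Sum>i\<le>n. {#C i#}) (DynA (n + 1))"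
| full_b: "L \<in> {C0', C0'', Cn', Cn''} \<Longrightarrow>
    full_shape n C0' C0'' C Cn' Cn'' ({#L#} + (\<Sum>i\<le>n. {#C i#})) (DynA (n + 2))"
| full_c: "L0 \<in> {C0', C0''} \<Longrightarrow> Ln \<in> {Cn', Cn''} \<Longrightarrow>
    full_shape n C0' C0'' C Cn' Cn'' ({#L0#} + (\<Sum>i\<le>n. {#C i#}) + {#Ln#}) (DynA (n + 3))"
| full_d_left:
    "full_shape n C0' C0'' C Cn' Cn'' ({#C0', C0''#} + (\<Sum>i\<le>n. {#C i#})) (DynD (n + 3))"
| full_d_right:
    "full_shape n C0' C0'' C Cn' Cn'' ((\<Sum>i\<le>n. {#C i#}) + {#Cn', Cn''#}) (DynD (n + 3))"
| full_e_left: "Ln \<in> {Cn', Cn''} \<Longrightarrow>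
    full_shape n C0' C0'' C Cn' Cn''
      ({#C0', C0''#} + (\<Sum>i\<le>n. {#C i#}) + {#Ln#}) (DynD (n + 4))"
| full_e_right: "L0 \<in> {C0', C0''} \<Longrightarrow>
    full_shape n C0' C0'' C Cn' Cn''
      ({#L0#} + (\<Sum>i\<le>n. {#C i#}) + {#Cn', Cn''#}) (DynD (n + 4))"

definition chain_count :: "nat \<Rightarrow> (nat \<Rightarrow> 'c) \<Rightarrow> 'c multiset \<Rightarrow> nat" where
  "chain_count n C \<Gamma> = card {X \<in> C ` {0..n}. X \<in># \<Gamma>}"

text \<open>\<open>D\<close> is a union of consecutive subchains of \<open>C a, \<dots>, C (b - 1)\<close> of lengths
  \<open>ls\<close>; the \<open>j\<close>-th one starts at \<open>C (s j)\<close>.\<close>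

definition separated_subchains ::
    "(nat \<Rightarrow> 'c) \<Rightarrow> nat \<Rightarrow> nat \<Rightarrow> nat list \<Rightarrow> 'c multiset \<Rightarrow> bool" where
  "separated_subchains C a b ls D \<longleftrightarrow>
     (\<forall>l\<in>set ls. l \<ge> 1) \<and>
     (\<exists>s. (\<forall>j<length ls. a \<le> s j \<and> s j + ls ! j \<le> b) \<and>
          (\<forall>i<length ls. \<forall>j<length ls. i \<noteq> j \<longrightarrow>
             s i + ls ! i < s j \<or> s j + ls ! j < s i) \<and>
          D = (\<Sum>j<length ls. \<Sum>k\<in>{s j..<s j + ls ! j}. {#C k#}))"

definition separate_case ::
    "('c \<Rightarrow> 'c \<Rightarrow> int) \<Rightarrow> nat \<Rightarrow> 'c \<Rightarrow> 'c \<Rightarrow> (nat \<Rightarrow> 'c) \<Rightarrow> 'c \<Rightarrow> 'c \<Rightarrow> 'c multiset \<Rightarrow> bool" where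
  "separate_case isect n C0' C0'' C Cn' Cn'' R \<longleftrightarrow>
     (let \<Gamma>\<^sub>L = component_of isect R (C 0);
          \<Gamma>\<^sub>R = component_of isect R (C n);
          c\<^sub>L = chain_count n C \<Gamma>\<^sub>L;
          c\<^sub>R = chain_count n C \<Gamma>\<^sub>R
      in \<Gamma>\<^sub>L \<noteq> \<Gamma>\<^sub>R \<and>
         (\<exists>R\<^sub>M. R = \<Gamma>\<^sub>L + R\<^sub>M + \<Gamma>\<^sub>R \<and>
            set_mset R\<^sub>M \<subseteq> {C i | i. c\<^sub>L + 1 \<le> i \<and> int i \<le> int n - int c\<^sub>R - 1} \<and>
            (R\<^sub>M = {#} \<or>
             (\<exists>ls. ls \<noteq> [] \<and> (\<forall>l\<in>set ls. l \<ge> 1) \<and>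
                has_type isect R\<^sub>M (mset (map DynA ls)) \<and>
                int (sum_list ls) + int (length ls) \<le> int n - int c\<^sub>L - int c\<^sub>R)) \<and>
            (R\<^sub>M = {#} \<longrightarrow> c\<^sub>L + c\<^sub>R \<le> n)) \<and>
         (\<exists>T. end_shape n C0' C0'' C \<Gamma>\<^sub>L c\<^sub>L T \<and> has_type isect \<Gamma>\<^sub>L {#T#}) \<and>
         (\<exists>T. end_shape n Cn' Cn'' (\<lambda>i. C (n - i)) \<Gamma>\<^sub>R c\<^sub>R T \<and> has_type isect \<Gamma>\<^sub>R {#T#}))"

definition joined_case ::
    "('c \<Rightarrow> 'c \<Rightarrow> int) \<Rightarrow> nat \<Rightarrow> 'c \<Rightarrow> 'c \<Rightarrow> (nat \<Rightarrow> 'c) \<Rightarrow> 'c \<Rightarrow> 'c \<Rightarrow> 'c multiset \<Rightarrow> bool" where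
  "joined_case isect n C0' C0'' C Cn' Cn'' R \<longleftrightarrow>
     (\<exists>\<Gamma>\<in>components isect R. C 0 \<in># \<Gamma> \<and> C n \<in># \<Gamma>) \<and>
     connected_divisor isect R \<and>
     (\<exists>T. full_shape n C0' C0'' C Cn' Cn'' R T \<and> has_type isect R {#T#})"

text \<open>The configurations of the converse direction. No Dynkin types are assumed here.\<close>

definition separate_configuration ::
    "nat \<Rightarrow> 'c \<Rightarrow> 'c \<Rightarrow> (nat \<Rightarrow> 'c) \<Rightarrow> 'c \<Rightarrow> 'c \<Rightarrow> 'c multiset \<Rightarrow> bool" where
  "separate_configuration n C0' C0'' C Cn' Cn'' R \<longleftrightarrow>
     (\<exists>\<Gamma>\<^sub>L R\<^sub>M \<Gamma>\<^sub>R c\<^sub>L c\<^sub>R. R = \<Gamma>\<^sub>L + R\<^sub>M + \<Gamma>\<^sub>R \<and>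
        c\<^sub>L = chain_count n C \<Gamma>\<^sub>L \<and> c\<^sub>R = chain_count n C \<Gamma>\<^sub>R \<and>
        (\<exists>c T. end_shape n C0' C0'' C \<Gamma>\<^sub>L c T) \<and>
        (\<exists>c T. end_shape n Cn' Cn'' (\<lambda>i. C (n - i)) \<Gamma>\<^sub>R c T) \<and>
        c\<^sub>L + c\<^sub>R \<le> n \<and>
        (R\<^sub>M = {#} \<or>
         (\<exists>ls. ls \<noteq> [] \<and> separated_subchains C (c\<^sub>L + 1) (n - c\<^sub>R) ls R\<^sub>M \<and>
            int (sum_list ls) + int (length ls) \<le> int n - int c\<^sub>L - int c\<^sub>R)))"

end

theory Submission
  imports Defs
begin

text \<open>
  If every \<open>C i\<close> lies in \<open>R\<close>, then \<open>R\<close> is connected, and some leaf is missing: otherwise \<open>C 0\<close>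
  and \<open>C n\<close> would be two vertices of valency at least 3 in one component, while a Dynkin diagram
  has at most one. The remaining choices of leaves give a path or a fork. If some \<open>C i\<close> is missing,
  the first gap from the left and the first gap from the right cut off the two end components, and
  the runs of consecutive curves between these gaps form the middle part. The right end is the left
  end of the reversed fiber. For the converse, each listed configuration misses a leaf or a
  chain curve, so the same two analyses provide its type.
\<close>

section \<open>Types of graphs\<close>

text \<open>The map \<open>g\<close> runs from the diagram to the graph, against the direction of
  \<open>graph_iso\<close>, so that applications can write down an explicit numbering of curves. Its
  inverse is tagged with index 0, because a single type is a disjoint union of one diagram.\<close>

lemma graph_has_type_single:
  assumes "dynkin_valid T" "bij_betw g (fst (dynkin_graph T)) (fst G)"
    and "\<And>i j. i \<in> fst (dynkin_graph T) \<Longrightarrow> j \<in> fst (dynkin_graph T) \<Longrightarrow>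
      (g i, g j) \<in> snd G \<longleftrightarrow> (i, j) \<in> snd (dynkin_graph T)"
  shows "graph_has_type G {#T#}"
proof -
  define H where "H = dynkin_graph T"
  define h where "h = inv_into (fst H) g"
  have h: "bij_betw h (fst G) (fst H)"
    unfolding h_def H_def by (rule bij_betw_inv_into[OF assms(2)])
  have gh: "g (h x) = x" if "x \<in> fst G" for x
    unfolding h_def H_def by (rule bij_betw_inv_into_right[OF assms(2) that])
  have hH: "h x \<in> fst H" if "x \<in> fst G" for x
    using h that by (auto simp: bij_betw_def)
  have "bij_betw (\<lambda>x. (0::nat, h x)) (fst G) (fst (disjoint_union [H]))"
    using h by (auto simp: bij_betw_def inj_on_def disjoint_union_def)
  moreover have "(x, y) \<in> snd G \<longleftrightarrow> ((0, h x), (0, h y)) \<in> snd (disjoint_union [H])"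
    if "x \<in> fst G" "y \<in> fst G" for x y
    using assms(3)[of "h x" "h y"] hH[OF that(1)] hH[OF that(2)] gh[OF that(1)] gh[OF that(2)]
    by (simp add: disjoint_union_def H_def)
  ultimately have "graph_iso G (disjoint_union (map dynkin_graph [T]))"
    unfolding graph_iso_def H_def by (intro exI[of _ "\<lambda>x. (0::nat, h x)"]) (auto simp: H_def)
  then show ?thesis
    unfolding graph_has_type_def using assms(1) by (intro conjI exI[of _ "[T]"]) auto
qed

text \<open>The dual graph only sees the support.\<close>

lemma has_type_cong:
  "set_mset R = set_mset R' \<Longrightarrow> has_type isect R M \<longleftrightarrow> has_type isect R' M"
  by (simp add: has_type_def dual_graph_def)

lemma has_type_empty: "has_type isect {#} {#}"
  by (auto simp: has_type_def graph_has_type_def graph_iso_def dual_graph_def disjoint_union_def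
      bij_betw_def)

text \<open>The lists of diagrams are concatenated. The hypothesis \<open>sep\<close> makes the
  supports disjoint and rules out edges between them, so the two isomorphisms can be glued.\<close>

lemma has_type_union:
  assumes 1: "has_type isect R1 M1" and 2: "has_type isect R2 M2"
    and sep: "\<And>X Y. X \<in># R1 \<Longrightarrow> Y \<in># R2 \<Longrightarrow> X \<noteq> Y \<and> isect X Y \<le> 0 \<and> isect Y X \<le> 0"
  shows "has_type isect (R1 + R2) (M1 + M2)"
proof -
  let ?D = "\<lambda>Ts. disjoint_union (map dynkin_graph Ts)"
  obtain Ts1 f1 where Ts1: "mset Ts1 = M1"
    and f1: "bij_betw f1 (set_mset R1) (fst (?D Ts1))"
    and e1: "\<And>x y. x \<in># R1 \<Longrightarrow> y \<in># R1 \<Longrightarrow>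
      x \<noteq> y \<and> isect x y > 0 \<longleftrightarrow> (f1 x, f1 y) \<in> snd (?D Ts1)"
    using 1 unfolding has_type_def graph_has_type_def graph_iso_def dual_graph_def by auto
  obtain Ts2 f2 where Ts2: "mset Ts2 = M2"
    and f2: "bij_betw f2 (set_mset R2) (fst (?D Ts2))"
    and e2: "\<And>x y. x \<in># R2 \<Longrightarrow> y \<in># R2 \<Longrightarrow>
      x \<noteq> y \<and> isect x y > 0 \<longleftrightarrow> (f2 x, f2 y) \<in> snd (?D Ts2)"
    using 2 unfolding has_type_def graph_has_type_def graph_iso_def dual_graph_def by auto
  define Ts where "Ts = Ts1 @ Ts2"
  define m where "m = length Ts1"
  \<comment> \<open>In the concatenated list the diagrams of \<open>R2\<close> come after the
    \<open>m\<close> diagrams of \<open>R1\<close>, so their indices move up by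
    \<open>m\<close>.\<close>
  define sh :: "nat \<times> nat \<Rightarrow> nat \<times> nat" where "sh = (\<lambda>(i, v). (i + m, v))"
  define f where "f x = (if x \<in># R1 then f1 x else sh (f2 x))" for x
  have V: "fst (?D Ts) = fst (?D Ts1) \<union> sh ` fst (?D Ts2)"
  proof (intro set_eqI iffI)
    fix z assume z: "z \<in> fst (?D Ts)"
    obtain i v where iv: "z = (i, v)" by (cases z)
    show "z \<in> fst (?D Ts1) \<union> sh ` fst (?D Ts2)"
    proof (cases "i < m")
      case True
      then show ?thesis using z iv by (auto simp: disjoint_union_def Ts_def m_def nth_append)
    next
      case False
      then have "z = sh (i - m, v)" "(i - m, v) \<in> fst (?D Ts2)"
        using z iv by (auto simp: disjoint_union_def Ts_def m_def nth_append sh_def)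
      then show ?thesis by blast
    qed
  next
    fix z assume "z \<in> fst (?D Ts1) \<union> sh ` fst (?D Ts2)"
    then show "z \<in> fst (?D Ts)"
      by (auto simp: disjoint_union_def Ts_def m_def nth_append sh_def)
  qed
  have E: "((i, u), (j, v)) \<in> snd (?D Us) \<longleftrightarrow>
      i = j \<and> i < length Us \<and> (u, v) \<in> snd (dynkin_graph (Us ! i))" for i j u v Us
    by (auto simp: disjoint_union_def)
  have lt: "fst (f1 x) < m" if "x \<in># R1" for x
  proof -
    have "f1 x \<in> fst (?D Ts1)" using f1 that by (auto simp: bij_betw_def)
    then show ?thesis by (auto simp: disjoint_union_def m_def)
  qed
  have ge: "fst (sh (f2 x)) \<ge> m" for x by (simp add: sh_def split: prod.split)
  have disj: "set_mset R1 \<inter> set_mset R2 = {}" using sep by blast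
  have "inj_on sh (fst (?D Ts2))" by (auto simp: inj_on_def sh_def)
  then have "bij_betw (sh \<circ> f2) (set_mset R2) (sh ` fst (?D Ts2))"
    using f2 by (meson bij_betw_trans inj_on_imp_bij_betw)
  then have b2: "bij_betw f (set_mset R2) (sh ` fst (?D Ts2))"
    using disj by (subst bij_betw_cong[of _ f "sh \<circ> f2"]) (auto simp: f_def)
  have b1: "bij_betw f (set_mset R1) (fst (?D Ts1))"
    using f1 by (subst bij_betw_cong[of _ f f1]) (auto simp: f_def)
  have "fst (?D Ts1) \<inter> sh ` fst (?D Ts2) = {}"
    by (auto simp: disjoint_union_def sh_def m_def)
  then have bij: "bij_betw f (set_mset (R1 + R2)) (fst (?D Ts))"
    unfolding V set_mset_union by (rule bij_betw_combine[OF b1 b2])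
  have edge: "x \<noteq> y \<and> isect x y > 0 \<longleftrightarrow> (f x, f y) \<in> snd (?D Ts)"
    if "x \<in># R1 + R2" "y \<in># R1 + R2" for x y
  proof -
    obtain i u where fx: "f x = (i, u)" by (cases "f x")
    obtain j v where fy: "f y = (j, v)" by (cases "f y")
    consider "x \<in># R1" "y \<in># R1" | "x \<in># R1" "y \<notin># R1" "y \<in># R2"
      | "x \<notin># R1" "x \<in># R2" "y \<in># R1" | "x \<notin># R1" "x \<in># R2" "y \<notin># R1" "y \<in># R2"
      using \<open>x \<in># R1 + R2\<close> \<open>y \<in># R1 + R2\<close> by auto
    then show ?thesis
    proof cases
      case 1
      then have "i < m" "f1 x = (i, u)" "f1 y = (j, v)" using lt[of x] fx fy by (auto simp: f_def)
      then show ?thesis using e1[OF 1] fx fy by (simp add: E) (auto simp: Ts_def m_def nth_append)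
    next
      case 2
      then have "i < m" "m \<le> j" using lt[of x] ge[of y] fx fy by (auto simp: f_def)
      then show ?thesis using sep[OF 2(1,3)] fx fy by (simp add: E)
    next
      case 3
      then have "j < m" "m \<le> i" using lt[of y] ge[of x] fx fy by (auto simp: f_def)
      then show ?thesis using sep[OF 3(3,2)] fx fy by (simp add: E)
    next
      case 4
      then obtain i' j' where "i = i' + m" "j = j' + m" "f2 x = (i', u)" "f2 y = (j', v)"
        using fx fy by (auto simp: f_def sh_def split: prod.splits)
      then show ?thesis using e2[OF 4(2,4)] fx fy
        by (simp add: E) (auto simp: Ts_def m_def nth_append)
    qed
  qed
  have "graph_iso (dual_graph isect (R1 + R2)) (?D Ts)"
    unfolding graph_iso_def using bij edge by (auto simp: dual_graph_def)
  moreover have "\<forall>T\<in>#M1 + M2. dynkin_valid T"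
    using 1 2 by (auto simp: has_type_def graph_has_type_def)
  ultimately show ?thesis
    using Ts1 Ts2 unfolding has_type_def graph_has_type_def
    by (intro conjI exI[of _ Ts]) (auto simp: Ts_def)
qed

section \<open>Trivalent vertices of Dynkin diagrams\<close>

lemma dynkin_graph_trivalent:
  assumes "dynkin_valid T"
  shows "\<exists>w. \<forall>v y1 y2 y3. (v, y1) \<in> snd (dynkin_graph T) \<and> (v, y2) \<in> snd (dynkin_graph T) \<and>
    (v, y3) \<in> snd (dynkin_graph T) \<and> distinct [y1, y2, y3] \<longrightarrow> v = w"
proof (cases T)
  case (DynA k)
  \<comment> \<open>A path has no vertex of valency 3, so any witness will do.\<close>
  show ?thesis by (rule exI[of _ 0]) (auto simp: DynA sym_closure_def)
next
  case (DynD l)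
  show ?thesis using assms by (intro exI[of _ "l - 2"]) (auto simp: DynD sym_closure_def)
next
  case (DynE m)
  show ?thesis by (rule exI[of _ 3]) (auto simp: DynE sym_closure_def)
qed

text \<open>The isomorphism sends connected vertices into one summand and keeps three distinct
  neighbours distinct. Hence both \<open>x\<close> and \<open>y\<close> go to the only trivalent
  vertex of that summand, and injectivity identifies them.\<close>

lemma has_type_trivalent_unique:
  assumes ty: "has_type isect R M"
    and xy: "(x, y) \<in> (snd (dual_graph isect R))\<^sup>*"
    and x: "distinct [x1, x2, x3]" "\<And>z. z \<in> {x1, x2, x3} \<Longrightarrow> (x, z) \<in> snd (dual_graph isect R)"
    and y: "distinct [y1, y2, y3]" "\<And>z. z \<in> {y1, y2, y3} \<Longrightarrow> (y, z) \<in> snd (dual_graph isect R)"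
  shows "x = y"
proof -
  let ?E = "snd (dual_graph isect R)"
  obtain Ts f where v: "\<forall>T\<in>set Ts. dynkin_valid T"
    and f: "bij_betw f (set_mset R) (fst (disjoint_union (map dynkin_graph Ts)))"
    and e: "\<And>u w. (u, w) \<in> ?E \<Longrightarrow>
      (f u, f w) \<in> snd (disjoint_union (map dynkin_graph Ts))"
    using ty unfolding has_type_def graph_has_type_def graph_iso_def dual_graph_def by clarsimp metis
  have inR: "u \<in># R \<and> w \<in># R" if "(u, w) \<in> ?E" for u w
    using that by (auto simp: dual_graph_def)
  have inj: "f u = f w \<longleftrightarrow> u = w" if "u \<in># R" "w \<in># R" for u w
    using f that by (auto simp: bij_betw_def inj_on_def)
  have e': "fst (f u) = fst (f w) \<and> fst (f u) < length Ts \<and>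
      (snd (f u), snd (f w)) \<in> snd (dynkin_graph (Ts ! fst (f u)))" if "(u, w) \<in> ?E" for u w
    using e[OF that] by (auto simp: disjoint_union_def)
  \<comment> \<open>Every edge of a disjoint union stays inside one summand, so the index is
    constant along a path.\<close>
  have same: "fst (f y) = fst (f x)"
    using xy by (induction rule: rtrancl_induct) (use e' in auto)
  define i where "i = fst (f x)"
  have "i < length Ts" using e'[OF x(2), of x1] by (simp add: i_def)
  then obtain w where w: "\<And>v y1 y2 y3. (v, y1) \<in> snd (dynkin_graph (Ts ! i)) \<Longrightarrow>
      (v, y2) \<in> snd (dynkin_graph (Ts ! i)) \<Longrightarrow> (v, y3) \<in> snd (dynkin_graph (Ts ! i)) \<Longrightarrow>
      distinct [y1, y2, y3] \<Longrightarrow> v = w"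
    using dynkin_graph_trivalent[of "Ts ! i"] v by (metis nth_mem)
  have *: "snd (f z) = w" if "fst (f z) = i" "distinct [z1, z2, z3]"
    and z: "\<And>t. t \<in> {z1, z2, z3} \<Longrightarrow> (z, t) \<in> ?E" for z z1 z2 z3
  proof (rule w)
    show "(snd (f z), snd (f z1)) \<in> snd (dynkin_graph (Ts ! i))"
      "(snd (f z), snd (f z2)) \<in> snd (dynkin_graph (Ts ! i))"
      "(snd (f z), snd (f z3)) \<in> snd (dynkin_graph (Ts ! i))"
      using e'[OF z] that(1) by auto
    have "f z1 \<noteq> f z2" "f z1 \<noteq> f z3" "f z2 \<noteq> f z3"
      using inj inR[OF z] that(2) by auto
    moreover have "fst (f z1) = i" "fst (f z2) = i" "fst (f z3) = i"
      using e'[OF z, of z1] e'[OF z, of z2] e'[OF z, of z3] that(1) by simp_all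
    ultimately show "distinct [snd (f z1), snd (f z2), snd (f z3)]"
      by (auto simp: prod_eq_iff)
  qed
  have "snd (f x) = w" by (rule *[of x x1 x2 x3]) (use x in \<open>auto simp: i_def\<close>)
  moreover have "snd (f y) = w" by (rule *[of y y1 y2 y3]) (use y same in \<open>auto simp: i_def\<close>)
  ultimately have "f x = f y" using same by (simp add: prod_eq_iff)
  then show ?thesis using inj inR x(2)[of x1] y(2)[of y1] by auto
qed

section \<open>Connected components and reduced divisors\<close>

text \<open>Closure under edges bounds the component from above, reachability from below. The
  candidate \<open>A\<close> may contain curves outside \<open>R\<close>, so reachability is only
  asked for on \<open>R\<close>.\<close>

lemma component_of_eqI:
  assumes reach: "\<And>Y. Y \<in> A \<Longrightarrow> Y \<in># R \<Longrightarrow> (X, Y) \<in> (snd (dual_graph isect R))\<^sup>*"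
    and closed: "\<And>Y Z. Y \<in> A \<Longrightarrow> (Y, Z) \<in> snd (dual_graph isect R) \<Longrightarrow> Z \<in> A"
    and "X \<in> A"
  shows "component_of isect R X = filter_mset (\<lambda>Y. Y \<in> A) R"
proof -
  have "Y \<in> A" if "(X, Y) \<in> (snd (dual_graph isect R))\<^sup>*" for Y
    using that by (induction rule: rtrancl_induct) (use assms in auto)
  then show ?thesis
    unfolding component_of_def by (intro filter_mset_cong) (use reach in auto)
qed

text \<open>Lets equality of reduced divisors be checked on supports.\<close>

lemma reduced_eq_mset_set: "reduced R \<Longrightarrow> R = mset_set (set_mset R)"
  by (rule multiset_eqI) (auto simp: reduced_def count_mset_set' not_in_iff)

lemma reduced_filter: "reduced R \<Longrightarrow> reduced (filter_mset P R)"
  by (auto simp: reduced_def)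

lemma sum_singleton_mset: "inj_on f A \<Longrightarrow> (\<Sum>i\<in>A. {#f i#}) = mset_set (f ` A)"
  using sum.reindex[of f A "\<lambda>x. {#x#}"] by simp


section \<open>Subdivisors of the fiber\<close>

context In_star_fiber
begin

lemma inj_C: "inj_on C {..n}"
proof -
  have "{0..<n + 1} = {..n}" by auto
  then show ?thesis using distinct_components by (simp add: distinct_map del: upt_Suc)
qed

lemma C_eq_iff: "i \<le> n \<Longrightarrow> j \<le> n \<Longrightarrow> C i = C j \<longleftrightarrow> i = j"
  using inj_C by (auto simp: inj_on_def)

lemma leaf_neq_C: "i \<le> n \<Longrightarrow> C0' \<noteq> C i" "i \<le> n \<Longrightarrow> C0'' \<noteq> C i"
    "i \<le> n \<Longrightarrow> Cn' \<noteq> C i" "i \<le> n \<Longrightarrow> Cn'' \<noteq> C i"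
  using distinct_components by (auto simp: image_iff)

lemma leaf_neq: "C0' \<noteq> C0''" "C0' \<noteq> Cn'" "C0' \<noteq> Cn''" "C0'' \<noteq> Cn'" "C0'' \<noteq> Cn''" "Cn' \<noteq> Cn''"
  using distinct_components by auto

lemmas neqs = leaf_neq leaf_neq[symmetric] leaf_neq_C leaf_neq_C[symmetric]

lemma set_F: "set_mset F = {C0', C0'', Cn', Cn''} \<union> C ` {..n}"
  unfolding fiber_eq sum_singleton_mset[OF inj_C] set_mset_union
  by (auto simp flip: count_greater_zero_iff)

text \<open>Adjacency independent of \<open>R\<close>: the dual graph of any \<open>R\<close> is the
  restriction of this relation to its support, see \<open>snd_dual\<close>.\<close>

definition nbr :: "'c \<Rightarrow> 'c \<Rightarrow> bool" where
  "nbr X Y \<longleftrightarrow> X \<noteq> Y \<and> isect X Y > 0"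

lemma nbr_iff:
  assumes "X \<in># F" "Y \<in># F"
  shows "nbr X Y \<longleftrightarrow> (X, Y) \<in> sym_closure ({(C i, C (i + 1)) | i. i < n} \<union>
              {(C 0, C0'), (C 0, C0''), (C n, Cn'), (C n, Cn'')})" (is "_ \<longleftrightarrow> _ \<in> ?E")
proof -
  \<comment> \<open>\<open>inter_eq\<close> only speaks of distinct curves, so the listed edges must
    be seen to contain no loop.\<close>
  have "(X, X) \<notin> ?E"
    by (auto simp: sym_closure_def neqs C_eq_iff)
  then show ?thesis using inter_eq[OF assms] by (cases "X = Y") (auto simp: nbr_def)
qed

lemma nbr_sym: "X \<in># F \<Longrightarrow> Y \<in># F \<Longrightarrow> nbr X Y \<longleftrightarrow> nbr Y X"
  by (auto simp: nbr_iff sym_closure_def)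

text \<open>The conclusion has the form of the separation hypothesis of
  \<open>has_type_union\<close>.\<close>

lemma nonpos_if_not_nbr:
  assumes "X \<in># F" "Y \<in># F" "X \<noteq> Y" "\<not> nbr X Y"
  shows "X \<noteq> Y \<and> isect X Y \<le> 0 \<and> isect Y X \<le> 0"
  using assms nbr_sym[OF assms(1,2)] by (auto simp: nbr_def)

lemma snd_dual: "snd (dual_graph isect R) = {(X, Y). X \<in># R \<and> Y \<in># R \<and> nbr X Y}"
  by (auto simp: dual_graph_def nbr_def)

lemma nbr_CC: "i \<le> n \<Longrightarrow> j \<le> n \<Longrightarrow> nbr (C i) (C j) \<longleftrightarrow> i = j + 1 \<or> j = i + 1"
  by (subst nbr_iff) (auto simp: set_F sym_closure_def neqs C_eq_iff)

lemma nbr_leafC: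
  assumes "i \<le> n"
  shows "nbr C0' (C i) \<longleftrightarrow> i = 0" "nbr C0'' (C i) \<longleftrightarrow> i = 0"
    "nbr Cn' (C i) \<longleftrightarrow> i = n" "nbr Cn'' (C i) \<longleftrightarrow> i = n"
    "nbr (C i) C0' \<longleftrightarrow> i = 0" "nbr (C i) C0'' \<longleftrightarrow> i = 0"
    "nbr (C i) Cn' \<longleftrightarrow> i = n" "nbr (C i) Cn'' \<longleftrightarrow> i = n"
  using assms by (subst nbr_iff; auto simp: set_F sym_closure_def neqs C_eq_iff)+

lemma nbr_leaves:
  assumes "X \<in> {C0', C0'', Cn', Cn''}" "Y \<in> {C0', C0'', Cn', Cn''}"
  shows "\<not> nbr X Y"
  using assms by (subst nbr_iff) (auto simp: set_F sym_closure_def neqs C_eq_iff)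

lemmas nbr_simps = nbr_CC nbr_leafC nbr_leaves

text \<open>The mirror symmetry of the dual graph. Interpreting the locale at this instance turns
  each result about the left end into one about the right end.\<close>

lemma reverse_fiber: "In_star_fiber isect n F Cn' Cn'' (\<lambda>i. C (n - i)) C0' C0''"
proof
  show "n \<ge> 1" by (rule n_ge_1)
  have "inj_on (\<lambda>i. C (n - i)) {0..<n+1}" by (auto simp: inj_on_def C_eq_iff)
  then show "distinct ([Cn', Cn'', C0', C0''] @ map (\<lambda>i. C (n - i)) [0..<n + 1])"
    by (auto simp: distinct_map neqs simp del: upt_Suc)
  have im: "(\<lambda>i. C (n - i)) ` {..n} = C ` {..n}"
    by (auto simp: image_iff) (metis diff_diff_cancel diff_le_self atMost_iff)
  have "(\<Sum>i\<le>n. {#C (n - i)#}) = (\<Sum>i\<le>n. {#C i#})"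
    using im by (subst (1 2) sum_singleton_mset) (auto simp: inj_on_def C_eq_iff)
  then show "F = {#Cn', Cn''#} + repeat_mset 2 (\<Sum>i\<le>n. {#C (n - i)#}) + {#C0', C0''#}"
    by (simp add: fiber_eq)
  show "isect X X = - 2" if "X \<in># F" for X using self_inter[OF that] .
  \<comment> \<open>Reversal sends the edge with index \<open>i\<close> to the one with index
    \<open>n - (i + 1)\<close> and flips its orientation, which the symmetric closure
    ignores.\<close>
  have *: "sym_closure {(C (n - i), C (n - (i + 1))) |i. i < n} =
      sym_closure {(C i, C (i + 1)) |i. i < n}"
  proof -
    have "\<exists>j. C (n - i) = C (j + 1) \<and> C (n - (i + 1)) = C j \<and> j < n" if "i < n" for i
      using that by (intro exI[of _ "n - (i + 1)"]) (auto simp: Suc_diff_Suc)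
    moreover have "\<exists>j. C i = C (n - (j + 1)) \<and> C (i + 1) = C (n - j) \<and> j < n" if "i < n" for i
      using that by (intro exI[of _ "n - (i + 1)"]) (auto simp: Suc_diff_Suc)
    ultimately show ?thesis unfolding sym_closure_def by blast
  qed
  have un: "sym_closure (A \<union> B) = sym_closure A \<union> sym_closure B" for A B :: "('c \<times> 'c) set"
    by (auto simp: sym_closure_def)
  have "sym_closure ({(C (n - i), C (n - (i + 1))) |i. i < n} \<union>
           {(C (n - 0), Cn'), (C (n - 0), Cn''), (C (n - n), C0'), (C (n - n), C0'')}) =
        sym_closure ({(C i, C (i + 1)) |i. i < n} \<union>
           {(C 0, C0'), (C 0, C0''), (C n, Cn'), (C n, Cn'')})"
    unfolding un * by (simp add: insert_commute)
  then show "isect X Y = (if (X, Y) \<in> sym_closure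
           ({(C (n - i), C (n - (i + 1))) |i. i < n} \<union>
            {(C (n - 0), Cn'), (C (n - 0), Cn''), (C (n - n), C0'), (C (n - n), C0'')})
        then 1 else 0)"
    if "X \<in># F" "Y \<in># F" "X \<noteq> Y" for X Y
    using inter_eq[OF that] by simp
qed

text \<open>With one leaf chosen at each end, the fiber contains the path
  \<open>L0, C 0, \<dots>, C n, Ln\<close>, indexed by \<open>0, \<dots>, n + 2\<close>.\<close>

definition path_at :: "'c \<Rightarrow> 'c \<Rightarrow> nat \<Rightarrow> 'c" where
  "path_at L0 Ln i = (if i = 0 then L0 else if i \<le> n + 1 then C (i - 1) else Ln)"

lemma path_at_image_C: "q \<le> n + 1 \<Longrightarrow> path_at L0 Ln ` {p + 1..<q + 1} = C ` {p..<q}"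
proof -
  assume "q \<le> n + 1"
  moreover have "{p + 1..<q + 1} = (\<lambda>i. i + 1) ` {p..<q}" by simp
  ultimately show ?thesis by (simp only: image_image) (auto simp: path_at_def)
qed

lemma path_at_image:
  assumes "p \<le> n + 1"
  shows "path_at L0 Ln ` {1..<p + 1} = C ` {..<p}"
    "path_at L0 Ln ` {0..<p + 1} = insert L0 (C ` {..<p})"
    "path_at L0 Ln ` {1..<n + 3} = insert Ln (C ` {..n})"
    "path_at L0 Ln ` {0..<n + 3} = insert L0 (insert Ln (C ` {..n}))"
proof -
  have C: "path_at L0 Ln ` {1..<q + 1} = C ` {..<q}" if "q \<le> n + 1" for q
    using path_at_image_C[OF that, of L0 Ln 0] by (simp add: atLeast0LessThan)
  show "path_at L0 Ln ` {1..<p + 1} = C ` {..<p}" by (rule C[OF assms])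
  have ins: "{0..<q + 1} = insert 0 {1..<q + 1}" for q :: nat by auto
  show "path_at L0 Ln ` {0..<p + 1} = insert L0 (C ` {..<p})"
    unfolding ins image_insert C[OF assms] by (simp add: path_at_def)
  have "{1..<n + 3} = insert (n + 2) {1..<(n + 1) + 1}" by auto
  then have "path_at L0 Ln ` {1..<n + 3} = insert Ln (path_at L0 Ln ` {1..<(n + 1) + 1})"
    by (simp only: image_insert) (simp add: path_at_def)
  also have "\<dots> = insert Ln (C ` {..n})"
    by (subst C) (simp_all add: lessThan_Suc_atMost)
  finally show *: "path_at L0 Ln ` {1..<n + 3} = insert Ln (C ` {..n})" .
  have "{0..<n + 3} = insert 0 {1..<n + 3}" by auto
  then show "path_at L0 Ln ` {0..<n + 3} = insert L0 (insert Ln (C ` {..n}))"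
    by (simp only: image_insert *) (simp add: path_at_def)
qed

section \<open>Dynkin types of paths and forks in the fiber\<close>

context
  fixes L0 Ln
  assumes L: "L0 \<in> {C0', C0''}" "Ln \<in> {Cn', Cn''}"
begin

lemma path_at_eq_iff: "i \<le> n + 2 \<Longrightarrow> j \<le> n + 2 \<Longrightarrow> path_at L0 Ln i = path_at L0 Ln j \<longleftrightarrow> i = j"
  using L by (auto simp: path_at_def neqs C_eq_iff)

lemma nbr_path_at:
  "i \<le> n + 2 \<Longrightarrow> j \<le> n + 2 \<Longrightarrow>
    nbr (path_at L0 Ln i) (path_at L0 Ln j) \<longleftrightarrow> i = j + 1 \<or> j = i + 1"
  using L n_ge_1 by (auto simp: path_at_def nbr_simps)

text \<open>The path has no chords by \<open>nbr_path_at\<close>, so an interval of it is again a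
  path. The left leaf belongs to it when \<open>a = 0\<close>, the right leaf when
  \<open>b = n + 3\<close>; every type A divisor below except the special \<open>A3_sp\<close>
  arises from such intervals.\<close>

lemma has_type_interval:
  assumes "a < b" "b \<le> n + 3" and R: "set_mset R = path_at L0 Ln ` {a..<b}"
  shows "has_type isect R {#DynA (b - a)#}"
  unfolding has_type_def
proof (rule graph_has_type_single[where g = "\<lambda>i. path_at L0 Ln (a + i - 1)"])
  \<comment> \<open>Dynkin vertices are numbered from 1 and positions in the interval from
    \<open>a\<close>, hence the shift by \<open>a - 1\<close>.\<close>
  have im: "{a..<b} = (\<lambda>i. a + i - 1) ` {1..b - a}"
  proof (intro set_eqI iffI)
    fix x assume "x \<in> {a..<b}"
    then show "x \<in> (\<lambda>i. a + i - 1) ` {1..b - a}" by (intro image_eqI[of _ _ "x + 1 - a"]) auto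
  qed (use assms in auto)
  show "bij_betw (\<lambda>i. path_at L0 Ln (a + i - 1)) (fst (dynkin_graph (DynA (b - a))))
      (fst (dual_graph isect R))"
    using assms unfolding bij_betw_def dual_graph_def R im
    by (auto simp: inj_on_def path_at_eq_iff image_image)
next
  fix i j assume ij: "i \<in> fst (dynkin_graph (DynA (b - a)))" "j \<in> fst (dynkin_graph (DynA (b - a)))"
  then have "a + i - 1 \<in> {a..<b}" "a + j - 1 \<in> {a..<b}"
    using assms(1) by auto
  then have "path_at L0 Ln (a + i - 1) \<in># R" "path_at L0 Ln (a + j - 1) \<in># R"
    unfolding R by (blast intro: imageI)+
  then have "(path_at L0 Ln (a + i - 1), path_at L0 Ln (a + j - 1)) \<in> snd (dual_graph isect R) \<longleftrightarrow>
      nbr (path_at L0 Ln (a + i - 1)) (path_at L0 Ln (a + j - 1))"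
    by (simp add: snd_dual)
  also have "\<dots> \<longleftrightarrow> (i, j) \<in> snd (dynkin_graph (DynA (b - a)))"
    using ij assms(1,2) by (subst nbr_path_at) (auto simp: sym_closure_def)
  finally show "(path_at L0 Ln (a + i - 1), path_at L0 Ln (a + j - 1)) \<in> snd (dual_graph isect R) \<longleftrightarrow>
      (i, j) \<in> snd (dynkin_graph (DynA (b - a)))" .
qed (use assms in auto)

end

text \<open>Here \<open>C0''\<close> is attached to \<open>C 0\<close>, which has position 1 on the
  path. The diagram branches at vertex \<open>b - 1\<close> of its long chain
  \<open>1, ..., b\<close>, so the path is read backwards, by \<open>b - i\<close>, and
  \<open>C0''\<close> becomes the last vertex \<open>b + 1\<close>.\<close>

lemma has_type_fork:
  assumes Ln: "Ln \<in> {Cn', Cn''}" and b: "3 \<le> b" "b \<le> n + 3"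
    and R: "set_mset R = insert C0'' (path_at C0' Ln ` {0..<b})"
  shows "has_type isect R {#DynD (b + 1)#}"
  unfolding has_type_def
proof (rule graph_has_type_single[where g = "\<lambda>i. if i = b + 1 then C0'' else path_at C0' Ln (b - i)"])
  let ?g = "\<lambda>i. if i = b + 1 then C0'' else path_at C0' Ln (b - i)"
  let ?P = "path_at C0' Ln"
  have neq: "?P i \<noteq> C0''" for i
    using Ln by (auto simp: path_at_def neqs)
  have P_eq: "i \<le> n + 2 \<Longrightarrow> j \<le> n + 2 \<Longrightarrow> ?P i = ?P j \<longleftrightarrow> i = j" for i j
    using path_at_eq_iff[of C0' Ln] Ln by auto
  have nbr_P: "i \<le> n + 2 \<Longrightarrow> j \<le> n + 2 \<Longrightarrow> nbr (?P i) (?P j) \<longleftrightarrow> i = j + 1 \<or> j = i + 1" for i j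
    using nbr_path_at[of C0' Ln] Ln by auto
  have nbr_C0'': "nbr C0'' (?P i) \<longleftrightarrow> i = 1" "nbr (?P i) C0'' \<longleftrightarrow> i = 1" for i
    using Ln by (auto simp: path_at_def nbr_simps)
  have set: "fst (dynkin_graph (DynD (b + 1))) = insert (b + 1) {1..b}" by auto
  have im: "{0..<b} = (\<lambda>i. b - i) ` {1..b}"
  proof (intro set_eqI iffI)
    fix x assume "x \<in> {0..<b}"
    then show "x \<in> (\<lambda>i. b - i) ` {1..b}" by (intro image_eqI[of _ _ "b - x"]) auto
  qed auto
  have "inj_on ?g (insert (b + 1) {1..b})"
    using b neq neq[symmetric] by (auto simp: inj_on_def P_eq)
  moreover have "?g ` insert (b + 1) {1..b} = insert C0'' (?P ` {0..<b})"
    unfolding im by (auto simp: image_iff)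
  ultimately show "bij_betw ?g (fst (dynkin_graph (DynD (b + 1)))) (fst (dual_graph isect R))"
    unfolding bij_betw_def set dual_graph_def R by simp
  then have inR: "?g i \<in># R" if "i \<in> fst (dynkin_graph (DynD (b + 1)))" for i
    using that unfolding bij_betw_def by (auto simp: dual_graph_def)
  fix i j assume ij: "i \<in> fst (dynkin_graph (DynD (b + 1)))" "j \<in> fst (dynkin_graph (DynD (b + 1)))"
  have "(?g i, ?g j) \<in> snd (dual_graph isect R) \<longleftrightarrow> nbr (?g i) (?g j)"
    using inR[OF ij(1)] inR[OF ij(2)] by (auto simp: snd_dual)
  also have "\<dots> \<longleftrightarrow> (i, j) \<in> snd (dynkin_graph (DynD (b + 1)))"
    using ij b by (auto simp: nbr_P nbr_C0'' nbr_leaves sym_closure_def)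
  finally show "(?g i, ?g j) \<in> snd (dual_graph isect R) \<longleftrightarrow>
    (i, j) \<in> snd (dynkin_graph (DynD (b + 1)))" .
qed (use b in auto)

text \<open>Both leaves sit at the same end, so this is no interval of a path
  \<open>path_at\<close>; it would be the fork with \<open>b = 2\<close>, whose type degenerates to
  A.\<close>

lemma has_type_A3_sp:
  assumes "set_mset R = {C0', C 0, C0''}"
  shows "has_type isect R {#DynA 3#}"
  unfolding has_type_def
proof (rule graph_has_type_single[where g = "\<lambda>i. if i = 1 then C0' else if i = 2 then C 0 else C0''"])
  let ?g = "\<lambda>i::nat. if i = 1 then C0' else if i = 2 then C 0 else C0''"
  have set: "fst (dynkin_graph (DynA 3)) = {1, 2, 3}" by auto
  show "bij_betw ?g (fst (dynkin_graph (DynA 3))) (fst (dual_graph isect R))"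
    unfolding bij_betw_def set dual_graph_def assms by (auto simp: neqs)
  show "(?g i, ?g j) \<in> snd (dual_graph isect R) \<longleftrightarrow> (i, j) \<in> snd (dynkin_graph (DynA 3))"
    if "i \<in> fst (dynkin_graph (DynA 3))" "j \<in> fst (dynkin_graph (DynA 3))" for i j
    using that unfolding set snd_dual assms by (auto simp: nbr_simps sym_closure_def)
qed auto

text \<open>The runs of \<open>S\<close> are split off from the left, each together with the gap after it.\<close>

lemma has_type_runs:
  assumes "S \<subseteq> {a..<b}" "a \<le> b + 1" "b \<le> n + 1"
  shows "\<exists>ls. (\<forall>l\<in>set ls. l \<ge> 1) \<and> has_type isect (mset_set (C ` S)) (mset (map DynA ls)) \<and>
    (S \<noteq> {} \<longrightarrow> ls \<noteq> []) \<and> sum_list ls + length ls \<le> b + 1 - a"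
  using assms
proof (induction "card S" arbitrary: S a rule: less_induct)
  case less
  have fin: "finite S" using less.prems(1) finite_subset by blast
  show ?case
  proof (cases "S = {}")
    case True
    then show ?thesis by (intro exI[of _ "[]"]) (auto simp: has_type_empty)
  next
    case False
    define m where "m = Min S"
    have m: "m \<in> S" and m_le: "\<And>i. i \<in> S \<Longrightarrow> m \<le> i"
      using fin False by (auto simp: m_def)
    \<comment> \<open>The first gap after the run starting at \<open>m\<close>. Since
      \<open>b\<close> is not in \<open>S\<close>, it serves as the gap if the run reaches the end
      of the interval.\<close>
    define m' where "m' = (LEAST i. m \<le> i \<and> i \<notin> S)"
    have "b \<notin> S" "m < b" using less.prems m by auto
    then have ex: "m \<le> b \<and> b \<notin> S" by auto
    have m': "m \<le> m' \<and> m' \<notin> S" unfolding m'_def using ex by (rule LeastI)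
    have m'b: "m' \<le> b" unfolding m'_def using ex by (rule Least_le)
    have run: "i \<in> S" if "m \<le> i" "i < m'" for i
      using not_less_Least[of i "\<lambda>i. m \<le> i \<and> i \<notin> S"] that by (auto simp: m'_def)
    have mm': "m < m'" using m m' by (metis le_neq_implies_less)
    define S' where "S' = S - {m..<m'}"
    have S'_gt: "m' + 1 \<le> i" if "i \<in> S'" for i
    proof -
      have "i \<in> S" "i \<notin> {m..<m'}" using that by (auto simp: S'_def)
      then have "m' \<le> i" "i \<noteq> m'" using m_le[of i] m' by auto
      then show ?thesis by simp
    qed
    have S: "S = {m..<m'} \<union> S'" using run by (auto simp: S'_def)
    have "S' \<subset> S" using m mm' by (auto simp: S'_def)
    then have "card S' < card S" using fin by (rule psubset_card_mono[rotated])
    moreover have S'sub: "S' \<subseteq> {m' + 1..<b}" using S'_gt less.prems(1) \<open>S' \<subset> S\<close> by auto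
    \<comment> \<open>The remaining interval starts after the gap, possibly at \<open>b + 1\<close>;
      the hypothesis \<open>a \<le> b + 1\<close> is weak enough to allow this.\<close>
    ultimately obtain ls where ls: "\<forall>l\<in>set ls. l \<ge> 1"
      "has_type isect (mset_set (C ` S')) (mset (map DynA ls))"
      "sum_list ls + length ls \<le> b + 1 - (m' + 1)"
      using less.hyps[of S' "m' + 1"] m'b less.prems by auto
    have le_n: "i \<le> n" if "i \<in> S" for i using that less.prems by auto
    have fin': "finite S'" using fin by (simp add: S'_def)
    have "set_mset (mset_set (C ` {m..<m'})) = path_at C0' Cn' ` {m + 1..<m' + 1}"
      using path_at_image_C[of m' C0' Cn' m] m'b less.prems by simp
    then have "has_type isect (mset_set (C ` {m..<m'})) {#DynA (m' - m)#}"
      using has_type_interval[of C0' Cn' "m + 1" "m' + 1" "mset_set (C ` {m..<m'})"]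
        mm' m'b less.prems by auto
    moreover have "X \<noteq> Y \<and> isect X Y \<le> 0 \<and> isect Y X \<le> 0"
      if XY: "X \<in># mset_set (C ` {m..<m'})" "Y \<in># mset_set (C ` S')" for X Y
    proof -
      obtain i j where ij: "X = C i" "Y = C j" "i \<in> {m..<m'}" "j \<in> S'"
        using XY fin' by auto
      then have "i \<le> n" "j \<le> n" "i + 1 < j" using le_n[of i] le_n[of j] S'_gt[of j] S by auto
      then show ?thesis unfolding ij
        by (intro nonpos_if_not_nbr) (auto simp: set_F nbr_CC C_eq_iff)
    qed
    ultimately have "has_type isect (mset_set (C ` {m..<m'}) + mset_set (C ` S'))
        ({#DynA (m' - m)#} + mset (map DynA ls))"
      by (intro has_type_union ls(2))
    moreover have "set_mset (mset_set (C ` {m..<m'}) + mset_set (C ` S')) =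
        set_mset (mset_set (C ` S))"
      using fin fin' by (subst S) (auto simp: image_Un)
    ultimately have "has_type isect (mset_set (C ` S)) ({#DynA (m' - m)#} + mset (map DynA ls))"
      using has_type_cong by blast
    then have "has_type isect (mset_set (C ` S)) (mset (map DynA ((m' - m) # ls)))" by simp
    moreover have "a \<le> m" using m less.prems by auto
    \<comment> \<open>The new run and its gap use \<open>m' - m + 1\<close> indices, and the rest at
      most \<open>b - m'\<close>, together \<open>b + 1 - m\<close>. The extra 1 in the bound pays
      for the gap after the last run, which may be \<open>b\<close> itself.\<close>
    ultimately show ?thesis
      using ls mm' m'b by (intro exI[of _ "(m' - m) # ls"]) auto
  qed
qed

section \<open>Divisors with a gap in the chain\<close>

text \<open>The missing curve \<open>C p\<close> cuts off the initial run together with the leaves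
  at \<open>C 0\<close>. As \<open>p \<le> n\<close>, the curve \<open>C n\<close> is not in the
  run, so the leaves at the right end cannot be reached. The shape then depends only on which of
  \<open>C0'\<close> and \<open>C0''\<close> lie in \<open>R\<close>.\<close>

lemma left_component:
  assumes R: "R \<subseteq># F" "reduced R" and p: "1 \<le> p" "p \<le> n"
    and run: "\<And>i. i < p \<Longrightarrow> C i \<in># R" and gap: "C p \<notin># R"
  defines "\<Gamma> \<equiv> component_of isect R (C 0)"
  shows "set_mset \<Gamma> = set_mset R \<inter> ({C0', C0''} \<union> C ` {..<p})" (is "_ = _ \<inter> ?A")
    and "reduced \<Gamma>" and "chain_count n C \<Gamma> = p"
    and "\<exists>T. end_shape n C0' C0'' C \<Gamma> p T \<and> has_type isect \<Gamma> {#T#}"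
proof -
  let ?E = "snd (dual_graph isect R)"
  have RF: "X \<in># F" if "X \<in># R" for X using R(1) that by (rule mset_subset_eqD)
  have reachC: "(C 0, C i) \<in> ?E\<^sup>*" if "i < p" for i
    using that
  proof (induction i)
    case (Suc i)
    then have "(C i, C (Suc i)) \<in> ?E"
      using run[of i] run[of "Suc i"] p by (auto simp: snd_dual nbr_CC)
    then show ?case using Suc by (auto intro: rtrancl_into_rtrancl)
  qed simp
  have "\<Gamma> = filter_mset (\<lambda>Y. Y \<in> ?A) R"
    unfolding \<Gamma>_def
  proof (rule component_of_eqI)
    show "C 0 \<in> ?A" using p by auto
    show "(C 0, Y) \<in> ?E\<^sup>*" if "Y \<in> ?A" "Y \<in># R" for Y
    proof -
      have "(C 0, Y) \<in> ?E" if "Y \<in> {C0', C0''}"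
        using that \<open>Y \<in># R\<close> run[of 0] p by (auto simp: snd_dual nbr_leafC)
      then show ?thesis using that(1) reachC by auto
    qed
    \<comment> \<open>The only curve outside the candidate set adjacent to it is \<open>C p\<close>,
      which is not in \<open>R\<close>.\<close>
    show "Z \<in> ?A" if "Y \<in> ?A" "(Y, Z) \<in> ?E" for Y Z
    proof -
      have Z: "Z \<in># R" "nbr Y Z" using that(2) by (auto simp: snd_dual)
      consider "Z \<in> {C0', C0''}" | "Z \<in> {Cn', Cn''}" | j where "Z = C j" "j \<le> n"
        using RF[OF Z(1)] by (auto simp: set_F)
      then show ?thesis
      proof cases
        case 2
        then show ?thesis using that(1) Z(2) p by (auto simp: nbr_simps)
      next
        case (3 j)
        then have "j \<noteq> p" using Z(1) gap by auto
        moreover have "j < p \<or> j = p" using that(1) Z(2) 3 p by (auto simp: nbr_simps)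
        ultimately show ?thesis using 3 by auto
      qed auto
    qed
  qed
  then show set: "set_mset \<Gamma> = set_mset R \<inter> ?A" and red: "reduced \<Gamma>"
    using R(2) by (auto intro: reduced_filter)
  have set': "set_mset \<Gamma> = (set_mset R \<inter> {C0', C0''}) \<union> C ` {..<p}"
    using run by (auto simp: set)
  have "{X \<in> C ` {0..n}. X \<in># \<Gamma>} = C ` {..<p}"
    using p by (auto simp: set' neqs C_eq_iff)
  moreover have inj: "inj_on C {..<p}" using inj_C by (rule inj_on_subset) (use p in auto)
  ultimately show "chain_count n C \<Gamma> = p"
    by (simp add: chain_count_def card_image)
  have \<Gamma>: "\<Gamma> = mset_set (set_mset \<Gamma>)" using red by (rule reduced_eq_mset_set)
  note sum = sum_singleton_mset[OF inj]
  have nin: "C0' \<notin> C ` {..<p}" "C0'' \<notin> C ` {..<p}" using p by (auto simp: neqs)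
  \<comment> \<open>These are the shapes (a), (b), (c), (d), in this order. With both leaves
    present, \<open>p = 1\<close> gives the special type and larger \<open>p\<close> a fork.\<close>
  consider "C0' \<notin># R" "C0'' \<notin># R" | L where "set_mset R \<inter> {C0', C0''} = {L}" "L \<in> {C0', C0''}"
    | "C0' \<in># R" "C0'' \<in># R" "p = 1" | "C0' \<in># R" "C0'' \<in># R" "2 \<le> p"
    using p(1) by fastforce
  then show "\<exists>T. end_shape n C0' C0'' C \<Gamma> p T \<and> has_type isect \<Gamma> {#T#}"
  proof cases
    case 1
    then have s: "set_mset \<Gamma> = C ` {..<p}" by (auto simp: set')
    have "\<Gamma> = (\<Sum>i<p. {#C i#})" using \<Gamma> by (simp add: sum s)
    then have "end_shape n C0' C0'' C \<Gamma> p (DynA p)" using end_shape.end_a[OF p] by simp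
    moreover have "has_type isect \<Gamma> {#DynA p#}"
      using has_type_interval[of C0' Cn' 1 "p + 1" \<Gamma>] p path_at_image(1)[of p C0' Cn']
      by (simp add: s)
    ultimately show ?thesis by blast
  next
    case (2 L)
    then have s: "set_mset \<Gamma> = insert L (C ` {..<p})" by (auto simp: set')
    have "\<Gamma> = {#L#} + (\<Sum>i<p. {#C i#})" using \<Gamma> nin 2(2) by (auto simp: sum s)
    then have "end_shape n C0' C0'' C \<Gamma> p (DynA (p + 1))" using end_shape.end_b[OF 2(2) p] by simp
    moreover have "has_type isect \<Gamma> {#DynA (p + 1)#}"
      using has_type_interval[of L Cn' 0 "p + 1" \<Gamma>] p path_at_image(2)[of p L Cn'] 2(2)
      by (simp add: s)
    ultimately show ?thesis by blast
  next
    case 3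
    then have s: "set_mset \<Gamma> = {C0', C 0, C0''}" by (auto simp: set')
    have "\<Gamma> = A3_sp C0' (C 0) C0''" using \<Gamma> by (simp add: A3_sp_def s neqs add_mset_commute)
    then have "end_shape n C0' C0'' C \<Gamma> p (DynA 3)"
      using end_shape.end_c[of n C0' C0'' C] 3(3) by simp
    then show ?thesis using has_type_A3_sp[OF s] by blast
  next
    case 4
    then have s: "set_mset \<Gamma> = insert C0'' (insert C0' (C ` {..<p}))" by (auto simp: set')
    have "\<Gamma> = {#C0', C0''#} + (\<Sum>i<p. {#C i#})"
      using \<Gamma> nin by (simp add: sum s neqs add_mset_commute)
    then have "end_shape n C0' C0'' C \<Gamma> p (DynD (p + 2))" using end_shape.end_d[OF 4(3) p(2)] by simp
    moreover have "has_type isect \<Gamma> {#DynD (p + 2)#}"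
      using has_type_fork[of Cn' "p + 1" \<Gamma>] p 4(3) path_at_image(2)[of p C0' Cn']
      by (simp add: s)
    ultimately show ?thesis by blast
  qed
qed

lemma reverse_chain_image: "(\<lambda>i. C (n - i)) ` {0..n} = C ` {0..n}"
proof (intro set_eqI iffI)
  fix X assume "X \<in> C ` {0..n}"
  then obtain i where "X = C i" "i \<le> n" by auto
  then show "X \<in> (\<lambda>i. C (n - i)) ` {0..n}" by (intro image_eqI[of _ _ "n - i"]) auto
qed auto

text \<open>No type is assumed for \<open>R\<close>, so the second conclusion can also serve the
  converse direction.\<close>

lemma separate_if_gap:
  assumes R: "R \<subseteq># F" "reduced R" "C 0 \<in># R" "C n \<in># R" and k: "k \<le> n" "C k \<notin># R"
  shows "separate_case isect n C0' C0'' C Cn' Cn'' R" and "\<exists>M. has_type isect R M"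
proof -
  interpret rev: In_star_fiber isect n F Cn' Cn'' "\<lambda>i. C (n - i)" C0' C0''
    by (rule reverse_fiber)
  \<comment> \<open>\<open>C p\<close> is the first gap from the left and \<open>C (n - q)\<close>
    the first from the right; they may coincide.\<close>
  define p where "p = (LEAST i. C i \<notin># R)"
  define q where "q = (LEAST i. C (n - i) \<notin># R)"
  have gp: "C p \<notin># R" unfolding p_def using k(2) by (rule LeastI)
  have runp: "C i \<in># R" if "i < p" for i using not_less_Least[of i "\<lambda>i. C i \<notin># R"] that
    by (auto simp: p_def)
  have k': "C (n - (n - k)) \<notin># R" using k by simp
  have gq: "C (n - q) \<notin># R" unfolding q_def
    using k' by (rule LeastI[of "\<lambda>i. C (n - i) \<notin># R"])
  have runq: "C (n - i) \<in># R" if "i < q" for i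
    using not_less_Least[of i "\<lambda>i. C (n - i) \<notin># R"] that by (auto simp: q_def)
  have "q \<le> n - k" unfolding q_def
    using k' by (rule Least_le[of "\<lambda>i. C (n - i) \<notin># R"])
  then have qn: "q \<le> n" by simp
  \<comment> \<open>Leftmost among all gaps, \<open>C p\<close> cannot lie beyond
    \<open>C (n - q)\<close>; this yields the bound on \<open>c_L + c_R\<close>.\<close>
  have "p \<le> n - q" unfolding p_def using gq by (rule Least_le)
  then have pq: "p + q \<le> n" using qn by simp
  have p1: "1 \<le> p" using gp R(3) by (cases p) auto
  have q1: "1 \<le> q" using gq R(4) by (cases q) auto
  define \<Gamma>L where "\<Gamma>L = component_of isect R (C 0)"
  define \<Gamma>R where "\<Gamma>R = component_of isect R (C n)"
  have pn: "p \<le> n" using pq by simp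
  note left = left_component[OF R(1,2) p1 pn runp gp, folded \<Gamma>L_def]
  \<comment> \<open>The reversed fiber starts at \<open>C (n - 0)\<close>, which is rewritten to
    \<open>C n\<close> so that the component can be folded.\<close>
  note right = rev.left_component[OF R(1,2) q1 qn runq gq, simplified diff_zero, folded \<Gamma>R_def]
  have cL: "chain_count n C \<Gamma>L = p" by (rule left(3))
  have cR: "chain_count n C \<Gamma>R = q"
    using right(3) by (simp add: chain_count_def reverse_chain_image)
  define S where "S = {i. p < i \<and> i < n - q \<and> C i \<in># R}"
  define RM where "RM = mset_set (C ` S)"
  have finS: "finite S" by (simp add: S_def)
  have setM: "set_mset RM = C ` S" by (simp add: RM_def finS)
  have rchain: "(\<lambda>i. C (n - i)) ` {..<q} = C ` {n - q<..n}"
  proof (intro set_eqI iffI)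
    fix X assume "X \<in> C ` {n - q<..n}"
    then obtain j where "X = C j" "n - q < j" "j \<le> n" by auto
    then show "X \<in> (\<lambda>i. C (n - i)) ` {..<q}"
      using qn by (intro image_eqI[of _ _ "n - j"]) auto
  qed (use q1 qn in auto)
  have setL: "set_mset \<Gamma>L = set_mset R \<inter> ({C0', C0''} \<union> C ` {..<p})" by (rule left(1))
  have setR: "set_mset \<Gamma>R = set_mset R \<inter> ({Cn', Cn''} \<union> C ` {n - q<..n})"
    using right(1) by (simp add: rchain)
  have RF: "X \<in># F" if "X \<in># R" for X using R(1) that by (rule mset_subset_eqD)
  have setR_eq: "set_mset R = set_mset \<Gamma>L \<union> set_mset RM \<union> set_mset \<Gamma>R"
  proof (intro set_eqI iffI)
    fix X assume X: "X \<in># R"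
    consider "X \<in> {C0', C0''}" | "X \<in> {Cn', Cn''}" | j where "X = C j" "j \<le> n"
      using RF[OF X] by (auto simp: set_F)
    then show "X \<in> set_mset \<Gamma>L \<union> set_mset RM \<union> set_mset \<Gamma>R"
    proof cases
      case (3 j)
      then have "j \<noteq> p" "j \<noteq> n - q" using X gp gq by auto
      then have "j < p \<or> (p < j \<and> j < n - q) \<or> n - q < j" by auto
      then show ?thesis using X 3 unfolding setL setR setM S_def by auto
    qed (use X in \<open>auto simp: setL setR\<close>)
  qed (auto simp: setL setR setM S_def)
  \<comment> \<open>The two gaps separate the three parts. The disjunction matches the nested sum
    \<open>(\<Gamma>L + RM) + \<Gamma>R\<close>, to which \<open>has_type_union\<close> is applied
    twice.\<close>
  have far: "X \<noteq> Y \<and> isect X Y \<le> 0 \<and> isect Y X \<le> 0"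
    if "X \<in># \<Gamma>L \<and> Y \<in># RM \<or> X \<in># \<Gamma>L + RM \<and> Y \<in># \<Gamma>R" for X Y
  proof (rule nonpos_if_not_nbr)
    show "X \<in># F" "Y \<in># F" using that setR_eq RF by auto
    show "X \<noteq> Y" "\<not> nbr X Y"
      using that pq q1 p1 unfolding setL setR setM S_def set_mset_union
      by (auto simp: nbr_simps neqs C_eq_iff)
  qed
  have disj: "set_mset \<Gamma>L \<inter> set_mset RM = {}"
      "(set_mset \<Gamma>L \<union> set_mset RM) \<inter> set_mset \<Gamma>R = {}"
    using far by fastforce+
  have Req: "R = \<Gamma>L + RM + \<Gamma>R"
  proof -
    have "R = mset_set (set_mset \<Gamma>L \<union> set_mset RM \<union> set_mset \<Gamma>R)"
      using reduced_eq_mset_set[OF R(2)] setR_eq by simp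
    also have "\<dots> = mset_set (set_mset \<Gamma>L) + mset_set (set_mset RM) + mset_set (set_mset \<Gamma>R)"
      using disj by (simp add: mset_set_Union)
    also have "\<dots> = \<Gamma>L + RM + \<Gamma>R"
      using reduced_eq_mset_set[OF left(2)] reduced_eq_mset_set[OF right(2)]
      by (simp add: setM RM_def[symmetric])
    finally show ?thesis .
  qed
  \<comment> \<open>With \<open>a = p + 1\<close> and \<open>b = n - q\<close> the bound
    \<open>b + 1 - a\<close> becomes \<open>n - p - q\<close>. If the gaps coincide, then
    \<open>a = b + 1\<close> and the interval is empty.\<close>
  have "S \<subseteq> {p + 1..<n - q}" "p + 1 \<le> n - q + 1" "n - q \<le> n + 1"
    using pq by (auto simp: S_def)
  from has_type_runs[OF this] obtain ls where ls: "\<forall>l\<in>set ls. l \<ge> 1"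
    "has_type isect RM (mset (map DynA ls))" "S \<noteq> {} \<longrightarrow> ls \<noteq> []"
    "sum_list ls + length ls \<le> n - q + 1 - (p + 1)" unfolding RM_def by auto
  obtain TL TR where TL: "end_shape n C0' C0'' C \<Gamma>L p TL" "has_type isect \<Gamma>L {#TL#}"
    and TR: "end_shape n Cn' Cn'' (\<lambda>i. C (n - i)) \<Gamma>R q TR" "has_type isect \<Gamma>R {#TR#}"
    using left(4) right(4) by blast
  have "has_type isect (\<Gamma>L + RM + \<Gamma>R) ({#TL#} + mset (map DynA ls) + {#TR#})"
    by (intro has_type_union TL TR ls) (use far in auto)
  then show "\<exists>M. has_type isect R M" using Req by metis
  have "C 0 \<in># \<Gamma>L" "C 0 \<notin># \<Gamma>R"
    using R(3) p1 q1 pq unfolding setL setR by (auto simp: neqs C_eq_iff)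
  then have "\<Gamma>L \<noteq> \<Gamma>R" by auto
  moreover have "set_mset RM \<subseteq> {C i |i. p + 1 \<le> i \<and> int i \<le> int n - int q - 1}"
    unfolding setM S_def by auto
  moreover have "RM = {#} \<or> (\<exists>ls. ls \<noteq> [] \<and> (\<forall>l\<in>set ls. l \<ge> 1) \<and>
      has_type isect RM (mset (map DynA ls)) \<and>
      int (sum_list ls) + int (length ls) \<le> int n - int p - int q)"
  proof (cases "S = {}")
    case False
    then show ?thesis using ls pq by (intro disjI2 exI[of _ ls]) auto
  qed (simp add: RM_def)
  ultimately show "separate_case isect n C0' C0'' C Cn' Cn'' R"
    unfolding separate_case_def Let_def \<Gamma>L_def[symmetric] \<Gamma>R_def[symmetric] cL cR
    using pq TL TR Req by blast
qed

section \<open>Divisors containing the whole chain\<close>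

lemma full_shape_reverse:
  assumes "full_shape n Cn' Cn'' (\<lambda>i. C (n - i)) C0' C0'' R T"
  shows "full_shape n C0' C0'' C Cn' Cn'' R T"
proof -
  \<comment> \<open>The reindexing rule sends \<open>i < m\<close> to \<open>m - Suc i\<close>; for
    \<open>m = Suc n\<close> this is \<open>n - i\<close>.\<close>
  have sum: "(\<Sum>i\<le>n. {#C (n - i)#}) = (\<Sum>i\<le>n. {#C i#})"
    by (rule sum.nat_diff_reindex[of "\<lambda>i. {#C i#}" "Suc n", simplified lessThan_Suc_atMost, simplified])
  show ?thesis using assms
  proof cases
    case full_a
    then show ?thesis using full_shape.full_a[of n C0' C0'' C Cn' Cn''] by (simp add: sum)
  next
    case (full_b L)
    then show ?thesis using full_shape.full_b[of L C0' C0'' Cn' Cn'' n C] by (auto simp: sum)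
  next
    case (full_c L0 Ln)
    then show ?thesis using full_shape.full_c[of Ln C0' C0'' L0 Cn' Cn'' n C]
      by (simp add: sum add_mset_commute)
  next
    case full_d_left
    then show ?thesis using full_shape.full_d_right[of n C0' C0'' C Cn' Cn'']
      by (simp add: sum)
  next
    case full_d_right
    then show ?thesis using full_shape.full_d_left[of n C0' C0'' C Cn' Cn'']
      by (simp add: sum)
  next
    case (full_e_left Ln)
    then show ?thesis using full_shape.full_e_right[of Ln C0' C0'' n C Cn' Cn'']
      by (simp add: sum add_mset_commute)
  next
    case (full_e_right L0)
    then show ?thesis using full_shape.full_e_left[of L0 Cn' Cn'' n C0' C0'' C]
      by (simp add: sum add_mset_commute)
  qed
qed

text \<open>With at most one leaf on the right, \<open>R\<close> is a path or a fork branching at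
  \<open>C 0\<close>. None, one or both leaves on the left and none or one on the right give six
  cases.\<close>

lemma full_shape_if_right_leaf_missing:
  assumes R: "R \<subseteq># F" "reduced R" and chain: "\<And>i. i \<le> n \<Longrightarrow> C i \<in># R"
    and leaf: "Cn' \<notin># R \<or> Cn'' \<notin># R"
  shows "\<exists>T. full_shape n C0' C0'' C Cn' Cn'' R T \<and> has_type isect R {#T#}"
proof -
  have "set_mset R \<subseteq> set_mset F" using R(1) by (rule set_mset_mono)
  then have set: "set_mset R =
      (set_mset R \<inter> {C0', C0''}) \<union> (set_mset R \<inter> {Cn', Cn''}) \<union> C ` {..n}"
    using chain by (auto simp: set_F)
  have Req: "R = mset_set (set_mset R)" using R(2) by (rule reduced_eq_mset_set)
  note sum = sum_singleton_mset[OF inj_C]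
  have nin: "C0' \<notin> C ` {..n}" "C0'' \<notin> C ` {..n}" "Cn' \<notin> C ` {..n}" "Cn'' \<notin> C ` {..n}"
    by (auto simp: neqs)
  have path: "path_at L0 Ln ` {1..<n + 2} = C ` {..n}"
    "path_at L0 Ln ` {0..<n + 2} = insert L0 (C ` {..n})" for L0 Ln
    using path_at_image(1,2)[of "n + 1" L0 Ln] by (simp_all add: lessThan_Suc_atMost)
  note path' = path_at_image(3,4)[OF order_refl]
  consider (none) "set_mset R \<inter> {C0', C0''} = {}"
    | (one) L where "set_mset R \<inter> {C0', C0''} = {L}" "L \<in> {C0', C0''}"
    | (both) "set_mset R \<inter> {C0', C0''} = {C0', C0''}" by fastforce
  note left = this
  consider (none) "set_mset R \<inter> {Cn', Cn''} = {}"
    | (one) L where "set_mset R \<inter> {Cn', Cn''} = {L}" "L \<in> {Cn', Cn''}"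
    using leaf by fastforce
  then show ?thesis
  proof cases
    case none
    note right = this
    from left show ?thesis
    proof cases
      case none
      have s: "set_mset R = C ` {..n}" using set right none by simp
      have "R = (\<Sum>i\<le>n. {#C i#})" using Req by (simp add: sum s)
      then have "full_shape n C0' C0'' C Cn' Cn'' R (DynA (n + 1))"
        by (simp only: full_shape.full_a)
      \<comment> \<open>\<open>path_at\<close> asks for a leaf at each end; the interval avoids both
        end positions, so any choice will do.\<close>
      moreover have "has_type isect R {#DynA (n + 1)#}"
        using has_type_interval[of C0' Cn' 1 "n + 2" R] path(1) by (simp add: s)
      ultimately show ?thesis by blast
    next
      case (one L)
      have s: "set_mset R = insert L (C ` {..n})" using set right one by simp
      have "R = {#L#} + (\<Sum>i\<le>n. {#C i#})" using Req one(2) nin by (auto simp: sum s)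
      then have "full_shape n C0' C0'' C Cn' Cn'' R (DynA (n + 2))"
        using full_shape.full_b[of L C0' C0'' Cn' Cn'' n C] one(2) by auto
      moreover have "has_type isect R {#DynA (n + 2)#}"
        using has_type_interval[of L Cn' 0 "n + 2" R] path(2) one(2) by (simp add: s)
      ultimately show ?thesis by blast
    next
      case both
      have s: "set_mset R = insert C0'' (insert C0' (C ` {..n}))" using set right both by auto
      have "R = {#C0', C0''#} + (\<Sum>i\<le>n. {#C i#})"
        using Req nin by (simp add: sum s neqs add_mset_commute)
      then have "full_shape n C0' C0'' C Cn' Cn'' R (DynD (n + 3))"
        by (simp only: full_shape.full_d_left)
      moreover have "has_type isect R {#DynD (n + 3)#}"
        using has_type_fork[of Cn' "n + 2" R] n_ge_1 path(2)[of C0' Cn']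
        by (simp add: s numeral_3_eq_3)
      ultimately show ?thesis by blast
    qed
  next
    case (one Ln)
    note right = this
    from left show ?thesis
    proof cases
      case none
      have s: "set_mset R = insert Ln (C ` {..n})" using set right none by simp
      have "R = {#Ln#} + (\<Sum>i\<le>n. {#C i#})" using Req right(2) nin by (auto simp: sum s)
      then have "full_shape n C0' C0'' C Cn' Cn'' R (DynA (n + 2))"
        using full_shape.full_b[of Ln C0' C0'' Cn' Cn'' n C] right(2) by auto
      moreover have "has_type isect R {#DynA (n + 2)#}"
        using has_type_interval[of C0' Ln 1 "n + 3" R] path'(1) right(2) by (simp add: s)
      ultimately show ?thesis by blast
    next
      case (one L)
      have s: "set_mset R = insert L (insert Ln (C ` {..n}))"
        using set right one by (simp add: insert_commute)
      have "R = {#L#} + (\<Sum>i\<le>n. {#C i#}) + {#Ln#}"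
        using Req one(2) right(2) nin by (auto simp: sum s neqs)
      then have "full_shape n C0' C0'' C Cn' Cn'' R (DynA (n + 3))"
        using full_shape.full_c[OF one(2) right(2)] by simp
      moreover have "has_type isect R {#DynA (n + 3)#}"
        using has_type_interval[of L Ln 0 "n + 3" R] path'(2) one(2) right(2) by (simp add: s)
      ultimately show ?thesis by blast
    next
      case both
      have s: "set_mset R = insert C0'' (insert C0' (insert Ln (C ` {..n})))"
        using set right both by auto
      have "R = {#C0', C0''#} + (\<Sum>i\<le>n. {#C i#}) + {#Ln#}"
        using Req nin right(2) by (auto simp: sum s neqs add_mset_commute)
      then have "full_shape n C0' C0'' C Cn' Cn'' R (DynD (n + 4))"
        using full_shape.full_e_left[OF right(2)] by simp
      moreover have "has_type isect R {#DynD (n + 4)#}"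
        using has_type_fork[of Ln "n + 3" R] right(2) path'(2)[of C0' Ln]
        by (simp add: s add.commute)
      ultimately show ?thesis by blast
    qed
  qed
qed

text \<open>The chain is connected and every leaf is attached to one of its ends.\<close>

lemma component_of_eq_if_chain:
  assumes R: "R \<subseteq># F" and chain: "\<And>i. i \<le> n \<Longrightarrow> C i \<in># R" and X: "X \<in># R"
  shows "component_of isect R X = R"
proof -
  let ?E = "snd (dual_graph isect R)"
  have RF: "Y \<in># F" if "Y \<in># R" for Y using R that by (rule mset_subset_eqD)
  have C: "(C 0, C i) \<in> ?E\<^sup>*" if "i \<le> n" for i
    using that
  proof (induction i)
    case (Suc i)
    then have "(C i, C (Suc i)) \<in> ?E"
      using chain by (auto simp: snd_dual nbr_CC)
    then show ?case using Suc by (auto intro: rtrancl_into_rtrancl)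
  qed simp
  have reach: "(C 0, Y) \<in> ?E\<^sup>*" if "Y \<in># R" for Y
  proof -
    consider "Y \<in> {C0', C0''}" | "Y \<in> {Cn', Cn''}" | j where "Y = C j" "j \<le> n"
      using RF[OF \<open>Y \<in># R\<close>] by (auto simp: set_F)
    then show ?thesis
    proof cases
      case 1
      then have "(C 0, Y) \<in> ?E" using that chain by (auto simp: snd_dual nbr_leafC)
      then show ?thesis by auto
    next
      case 2
      then have "(C n, Y) \<in> ?E" using that chain by (auto simp: snd_dual nbr_leafC)
      then show ?thesis using C[of n] by (auto intro: rtrancl_into_rtrancl)
    qed (use C in auto)
  qed
  \<comment> \<open>Paths were built from \<open>C 0\<close>; symmetry reverses one of them, giving
    a path from \<open>X\<close> through \<open>C 0\<close> to any curve of
    \<open>R\<close>.\<close>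
  have "sym ?E" using RF nbr_sym by (auto simp: sym_def snd_dual)
  then have "(X, C 0) \<in> ?E\<^sup>*" using reach[OF X] by (meson sym_rtrancl symD)
  then have "(X, Y) \<in> ?E\<^sup>*" if "Y \<in># R" for Y using reach[OF that] by (rule rtrancl_trans)
  then have "component_of isect R X = {#Y \<in># R. Y \<in> set_mset R#}"
    by (intro component_of_eqI) (auto simp: snd_dual X)
  also have "\<dots> = R" by (simp add: filter_mset_eq_conv)
  finally show ?thesis .
qed

text \<open>If the missing leaf is not on the right, it is on the right of the reversed
  fiber.\<close>

lemma full_shape_exists:
  assumes R: "R \<subseteq># F" "reduced R" and chain: "\<And>i. i \<le> n \<Longrightarrow> C i \<in># R"
    and leaf: "\<not> {C0', C0'', Cn', Cn''} \<subseteq> set_mset R"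
  shows "\<exists>T. full_shape n C0' C0'' C Cn' Cn'' R T \<and> has_type isect R {#T#}"
proof (cases "Cn' \<notin># R \<or> Cn'' \<notin># R")
  case True
  then show ?thesis using full_shape_if_right_leaf_missing[OF R chain] by blast
next
  case False
  interpret rev: In_star_fiber isect n F Cn' Cn'' "\<lambda>i. C (n - i)" C0' C0''
    by (rule reverse_fiber)
  have "C0' \<notin># R \<or> C0'' \<notin># R" using False leaf by auto
  then show ?thesis
    using rev.full_shape_if_right_leaf_missing[OF R] chain full_shape_reverse by auto
qed

text \<open>Keeps the joined case apart from divisors with a gap. Together with
  \<open>full_shape_leaf_missing\<close> it also brings the listed divisors under
  \<open>full_shape_exists\<close> in the converse.\<close>

lemma full_shape_chain:
  assumes "full_shape n C0' C0'' C Cn' Cn'' R T" "i \<le> n"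
  shows "C i \<in># R"
proof -
  have "C i \<in> C ` {..n}" using assms(2) by simp
  with assms(1) show ?thesis by cases (auto simp: sum_singleton_mset[OF inj_C])
qed

lemma full_shape_leaf_missing:
  assumes "full_shape n C0' C0'' C Cn' Cn'' R T"
  shows "\<not> {C0', C0'', Cn', Cn''} \<subseteq> set_mset R"
proof -
  have nin: "C0' \<notin> C ` {..n}" "C0'' \<notin> C ` {..n}" "Cn' \<notin> C ` {..n}" "Cn'' \<notin> C ` {..n}"
    by (auto simp: neqs)
  show ?thesis
    using assms by cases (auto simp: sum_singleton_mset[OF inj_C] leaf_neq leaf_neq[symmetric] nin)
qed

text \<open>With all four leaves, \<open>C 0\<close> and \<open>C n\<close> would be distinct
  trivalent vertices of one component, contrary to \<open>has_type_trivalent_unique\<close>.\<close>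

lemma ADER_leaf_missing:
  assumes "ADER isect F R" and chain: "\<And>i. i \<le> n \<Longrightarrow> C i \<in># R"
  shows "\<not> {C0', C0'', Cn', Cn''} \<subseteq> set_mset R"
proof
  assume leaves: "{C0', C0'', Cn', Cn''} \<subseteq> set_mset R"
  obtain M where M: "has_type isect R M" and R: "R \<subseteq># F" using assms(1) by (auto simp: ADER_def)
  have "C n \<in># component_of isect R (C 0)"
    using component_of_eq_if_chain[OF R chain] chain by simp
  then have "(C 0, C n) \<in> (snd (dual_graph isect R))\<^sup>*"
    by (simp add: component_of_def)
  then have "C 0 = C n"
  proof (rule has_type_trivalent_unique[OF M])
    \<comment> \<open>The third neighbour of each end is the next chain curve, which exists as
      \<open>n \<ge> 1\<close>; for \<open>n = 1\<close> the ends are each other's third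
      neighbour.\<close>
    show "distinct [C0', C0'', C 1]" "distinct [Cn', Cn'', C (n - 1)]"
      using n_ge_1 by (auto simp: neqs)
    show "(C 0, z) \<in> snd (dual_graph isect R)" if "z \<in> {C0', C0'', C 1}" for z
      using that leaves chain n_ge_1 by (auto simp: snd_dual nbr_simps)
    show "(C n, z) \<in> snd (dual_graph isect R)" if "z \<in> {Cn', Cn'', C (n - 1)}" for z
      using that leaves chain n_ge_1 by (auto simp: snd_dual nbr_simps)
  qed
  then show False using n_ge_1 by (simp add: C_eq_iff)
qed

section \<open>Gaps in the configurations of the converse\<close>

text \<open>Confirms that the number \<open>c\<close> asserted by \<open>end_shape\<close> is the
  actual count, as \<open>separate_configuration\<close> uses only the latter.\<close>

lemma end_shape_chain:
  assumes "end_shape n C0' C0'' C \<Gamma> c T"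
  shows "1 \<le> c" "c \<le> n" "set_mset \<Gamma> \<inter> C ` {0..n} = C ` {..<c}" "chain_count n C \<Gamma> = c"
proof -
  show c: "1 \<le> c" "c \<le> n" using assms n_ge_1 by (cases; simp)+
  have inj: "inj_on C {..<p}" if "p \<le> n" for p
    using inj_C by (rule inj_on_subset) (use that in auto)
  show *: "set_mset \<Gamma> \<inter> C ` {0..n} = C ` {..<c}"
    using assms by cases (auto simp: sum_singleton_mset[OF inj] neqs A3_sp_def)
  have "{X \<in> C ` {0..n}. X \<in># \<Gamma>} = C ` {..<c}" using * by auto
  then show "chain_count n C \<Gamma> = c"
    using inj[OF c(2)] by (simp add: chain_count_def card_image)
qed

text \<open>The gap is \<open>C c\<close>, the chain curve right after the left part. The middle
  subchains start at \<open>C (c + 1)\<close> or later, and \<open>c + d \<le> n\<close> keeps the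
  right part beyond it.\<close>

lemma separate_configuration_gap:
  assumes "separate_configuration n C0' C0'' C Cn' Cn'' R"
  shows "C 0 \<in># R" "C n \<in># R" "\<exists>k\<le>n. C k \<notin># R"
proof -
  interpret rev: In_star_fiber isect n F Cn' Cn'' "\<lambda>i. C (n - i)" C0' C0''
    by (rule reverse_fiber)
  from assms obtain \<Gamma>L RM \<Gamma>R c d T U where R: "R = \<Gamma>L + RM + \<Gamma>R"
    and L: "end_shape n C0' C0'' C \<Gamma>L c T"
    and Rt: "end_shape n Cn' Cn'' (\<lambda>i. C (n - i)) \<Gamma>R d U"
    and le: "chain_count n C \<Gamma>L + chain_count n C \<Gamma>R \<le> n"
    and M: "RM = {#} \<or> (\<exists>ls. separated_subchains C (chain_count n C \<Gamma>L + 1)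
        (n - chain_count n C \<Gamma>R) ls RM)"
    unfolding separate_configuration_def by blast
  note left = end_shape_chain[OF L]
  note right = rev.end_shape_chain[OF Rt, unfolded reverse_chain_image]
  have d: "chain_count n C \<Gamma>R = d"
    using right(4) by (simp add: chain_count_def reverse_chain_image)
  have cd: "c + d \<le> n" using le left(4) d by simp
  have "C 0 \<in> C ` {..<c}" using left(1) by auto
  then show "C 0 \<in># R" using left(3) R by auto
  have "C n \<in> (\<lambda>i. C (n - i)) ` {..<d}" using right(1) by (intro image_eqI[of _ _ 0]) auto
  then show "C n \<in># R" using right(3) R by auto
  have "C c \<notin># \<Gamma>L"
  proof
    assume "C c \<in># \<Gamma>L"
    then have "C c \<in> C ` {..<c}" using left(2,3) by auto
    then show False using left(2) by (auto simp: C_eq_iff)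
  qed
  moreover have "C c \<notin># \<Gamma>R"
  proof
    assume "C c \<in># \<Gamma>R"
    then have "C c \<in> (\<lambda>i. C (n - i)) ` {..<d}" using left(2) right(3) by auto
    then show False using cd left(2) by (auto simp: C_eq_iff)
  qed
  moreover have "C c \<notin># RM"
  proof
    assume "C c \<in># RM"
    with M obtain ls s where s: "\<forall>j<length ls. c + 1 \<le> s j \<and> s j + ls ! j \<le> n - d"
      "C c \<in># (\<Sum>j<length ls. \<Sum>k\<in>{s j..<s j + ls ! j}. {#C k#})"
      unfolding separated_subchains_def left(4) d by force
    then obtain j k where "j < length ls" "k \<in> {s j..<s j + ls ! j}" "C c = C k"
      by (auto simp: set_mset_sum)
    then show False using s(1) cd left(2) by (force simp: C_eq_iff)
  qed
  ultimately show "\<exists>k\<le>n. C k \<notin># R" using R left(2) by auto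
qed

end

theorem proposition11p8:
  fixes isect :: "'c \<Rightarrow> 'c \<Rightarrow> int"
    and n :: nat
    and F :: "'c multiset"
    and C0' C0'' :: 'c
    and C :: "nat \<Rightarrow> 'c"
    and Cn' Cn'' :: 'c
  assumes "In_star_fiber isect n F C0' C0'' C Cn' Cn''"
  shows "(\<forall>R. ADER isect F R \<and> C 0 \<in># R \<and> C n \<in># R \<longrightarrow>
            (separate_case isect n C0' C0'' C Cn' Cn'' R \<or>
             joined_case isect n C0' C0'' C Cn' Cn'' R) \<and>
            \<not> (separate_case isect n C0' C0'' C Cn' Cn'' R \<and>
               joined_case isect n C0' C0'' C Cn' Cn'' R)) \<and>
         (\<forall>R. R \<subseteq># F \<and> reduced R \<and>
            (separate_configuration n C0' C0'' C Cn' Cn'' R \<or>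
             (\<exists>T. full_shape n C0' C0'' C Cn' Cn'' R T)) \<longrightarrow>
            ADER isect F R)"
proof -
  interpret In_star_fiber isect n F C0' C0'' C Cn' Cn'' by (rule assms)
  \<comment> \<open>For truth values, being different means that exactly one holds. The split is by
    whether \<open>R\<close> contains the whole chain.\<close>
  have "separate_case isect n C0' C0'' C Cn' Cn'' R \<noteq> joined_case isect n C0' C0'' C Cn' Cn'' R"
    if A: "ADER isect F R" and ends: "C 0 \<in># R" "C n \<in># R" for R
  proof (cases "\<forall>i\<le>n. C i \<in># R")
    case True
    then have chain: "C i \<in># R" if "i \<le> n" for i using that by simp
    have R: "R \<subseteq># F" "reduced R" using A by (auto simp: ADER_def)
    have comp: "component_of isect R X = R" if "X \<in># R" for X
      using component_of_eq_if_chain[OF R(1) chain that] .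
    then have "components isect R = {R}" using ends by (auto simp: components_def)
    then have "joined_case isect n C0' C0'' C Cn' Cn'' R"
      using full_shape_exists[OF R chain ADER_leaf_missing[OF A chain]] ends
      by (simp add: joined_case_def connected_divisor_def)
    \<comment> \<open>Both end components equal \<open>R\<close>, so they are not different.\<close>
    moreover have "\<not> separate_case isect n C0' C0'' C Cn' Cn'' R"
      using comp ends by (simp add: separate_case_def)
    ultimately show ?thesis by simp
  next
    case False
    then have "separate_case isect n C0' C0'' C Cn' Cn'' R"
      using separate_if_gap(1) A ends by (auto simp: ADER_def)
    \<comment> \<open>A full shape would contain every chain curve.\<close>
    moreover have "\<not> joined_case isect n C0' C0'' C Cn' Cn'' R"
      using False full_shape_chain by (auto simp: joined_case_def)
    ultimately show ?thesis by simp
  qed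
  moreover have "ADER isect F R" if R: "R \<subseteq># F" "reduced R" and
    "separate_configuration n C0' C0'' C Cn' Cn'' R \<or>
      (\<exists>T. full_shape n C0' C0'' C Cn' Cn'' R T)" for R
    using that(3)
  proof
    assume "separate_configuration n C0' C0'' C Cn' Cn'' R"
    then show ?thesis
      using separate_configuration_gap separate_if_gap(2)[OF R] R by (meson ADER_def)
  next
    assume "\<exists>T. full_shape n C0' C0'' C Cn' Cn'' R T"
    then show ?thesis
      using full_shape_exists[OF R] full_shape_chain full_shape_leaf_missing R by (meson ADER_def)
  qed
  ultimately show ?thesis by blast
qed

end
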